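(* For $0\le r_1,r_2\le n$, $0\le s\le N(r_1,r_2)$ and $t\in\mathbb C$: $$\lambda_s^{r_1,r_2}(t,n)=\sum_{j=0}^s(-1)^j\binom{t}{j}\frac{[s]_j\,[n-s+1]_j}{[n-r_1]_j\,[r_2]_j};$$ if $s\ge1$, then $$\Delta\lambda_s^{r_1,r_2}(t,n)=-\frac{s(n-s+1)}{r_2(n-r_1)}\,\lambda_{s-1}^{r_1-1,r_2-1}(t,n-2);$$ and the leading coefficient (of $t^s$) of $\lambda_s^{r_1,r_2}(t,n)$ is $$a_s^{r_1,r_2}(n)=(-1)^s\frac{[n-s+1]_s}{[n-r_1]_s\,[r_2]_s}.$$
   Context: For a finite set $\Omega$ with $|\Omega|=n\ge1$, let $G=S(\Omega)$, $X=\mathcal P(\Omega)$, $X_r=\{x\in X:|x|=r\}$, with $G$ acting on $L^2(X)$ (complex functions on $X$; $L^2(X_r)$ = functions supported on $X_r$) by $(\rho(g)\psi)(x)=\psi(g^{-1}x)$. For $0\le s\le\min(r,n-r)$, $L^2(X_r)_s$ is the unique irreducible $G$-subspace of $L^2(X_r)$ isomorphic to the irreducible representation associated with the partition $(n-s,s)$. $N(r_1,r_2)=\min(r_1,n-r_1,r_2,n-r_2)$. For $0\le s\le N(r_1,r_2)$, $\Lambda_s^{r_1,r_2}$ is a $G$-equivariant map $L^2(X)\to L^2(X)$ sending $L^2(X_{r_1})_s$ into $L^2(X_{r_2})_s$ and vanishing on its orthogonal complement, with kernel $\lambda$ defined on integers $\max(0,r_2-r_1)\le k\le\min(n-r_1,r_2)$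 by $(\Lambda_s^{r_1,r_2}\psi)(x_2)=\sum_{x_1\in X_{r_1}}\lambda(|x_2\setminus x_1|)\psi(x_1)$. The kernel agrees on its domain with a unique polynomial of degree $s$ which is nonzero at $0$; $\Lambda_s^{r_1,r_2}$ is normalized so that this polynomial takes the value $1$ at $t=0$, and this polynomial is denoted $\lambda_s^{r_1,r_2}(t,n)$; the same construction with a set of $n-2$ elements gives $\lambda_{s'}^{r_1',r_2'}(t,n-2)$. $\Delta h(t)=h(t+1)-h(t)$; $\binom{t}{j}=[t]_j/j!$; $[\alpha]_k=\alpha(\alpha-1)\cdots(\alpha-k+1)$. *)

theory Defs
  imports "HOL-Combinatorics.Permutations" "HOL-Computational_Algebra.Polynomial"
begin

definition Xr :: "nat \<Rightarrow> nat \<Rightarrow> nat set set" where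
  "Xr n r = {x. x \<subseteq> {0..<n} \<and> card x = r}"

definition L2X :: "nat \<Rightarrow> (nat set \<Rightarrow> complex) set" where
  "L2X n = {\<psi>. \<forall>x. \<psi> x \<noteq> 0 \<longrightarrow> x \<subseteq> {0..<n}}"

definition L2Xr :: "nat \<Rightarrow> nat \<Rightarrow> (nat set \<Rightarrow> complex) set" where
  "L2Xr n r = {\<psi>. \<forall>x. \<psi> x \<noteq> 0 \<longrightarrow> x \<in> Xr n r}"

definition Sym :: "nat \<Rightarrow> (nat \<Rightarrow> nat) set" where
  "Sym n = {g. g permutes {0..<n}}"

definition rho :: "(nat \<Rightarrow> nat) \<Rightarrow> (nat set \<Rightarrow> complex) \<Rightarrow> (nat set \<Rightarrow> complex)" where
  "rho g \<psi> = (\<lambda>x. \<psi> (inv g ` x))"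

definition csubspace :: "(nat set \<Rightarrow> complex) set \<Rightarrow> bool" where
  "csubspace W \<longleftrightarrow> (\<lambda>_. 0) \<in> W \<and> (\<forall>\<phi>\<in>W. \<forall>\<psi>\<in>W. (\<lambda>x. \<phi> x + \<psi> x) \<in> W)
      \<and> (\<forall>c. \<forall>\<phi>\<in>W. (\<lambda>x. c * \<phi> x) \<in> W)"

definition G_invariant :: "nat \<Rightarrow> (nat set \<Rightarrow> complex) set \<Rightarrow> bool" where
  "G_invariant n W \<longleftrightarrow> (\<forall>g\<in>Sym n. \<forall>\<psi>\<in>W. rho g \<psi> \<in> W)"

definition G_iso :: "nat \<Rightarrow> (nat set \<Rightarrow> complex) set \<Rightarrow> (nat set \<Rightarrow> complex) set \<Rightarrow> bool" where
  "G_iso n V W \<longleftrightarrow> (\<exists>T. bij_betw T V W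
      \<and> (\<forall>\<phi>\<in>V. \<forall>\<psi>\<in>V. T (\<lambda>x. \<phi> x + \<psi> x) = (\<lambda>x. T \<phi> x + T \<psi> x))
      \<and> (\<forall>c. \<forall>\<phi>\<in>V. T (\<lambda>x. c * \<phi> x) = (\<lambda>x. c * T \<phi> x))
      \<and> (\<forall>g\<in>Sym n. \<forall>\<phi>\<in>V. T (rho g \<phi>) = rho g (T \<phi>)))"

text \<open>Irreducible representation of S_n for the partition (n-s,s), s <= n/2, realised as
  the Specht module = kernel of the down map L2(X_s) -> L2(X_(s-1)) (James' kernel theorem).\<close>
definition Specht :: "nat \<Rightarrow> nat \<Rightarrow> (nat set \<Rightarrow> complex) set" where
  "Specht n s = {\<phi> \<in> L2Xr n s. s \<ge> 1 \<longrightarrow>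
      (\<forall>y\<in>Xr n (s - 1). (\<Sum>x\<in>{x\<in>Xr n s. y \<subseteq> x}. \<phi> x) = 0)}"

definition is_comp :: "nat \<Rightarrow> nat \<Rightarrow> nat \<Rightarrow> (nat set \<Rightarrow> complex) set \<Rightarrow> bool" where
  "is_comp n r s W \<longleftrightarrow> W \<subseteq> L2Xr n r \<and> csubspace W \<and> G_invariant n W \<and> G_iso n (Specht n s) W"

definition comp :: "nat \<Rightarrow> nat \<Rightarrow> nat \<Rightarrow> (nat set \<Rightarrow> complex) set" where
  "comp n r s = (THE W. is_comp n r s W)"

definition inner :: "nat \<Rightarrow> (nat set \<Rightarrow> complex) \<Rightarrow> (nat set \<Rightarrow> complex) \<Rightarrow> complex" where
  "inner n \<phi> \<psi> = (\<Sum>x\<in>Pow {0..<n}. \<phi> x * cnj (\<psi> x))"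

definition kerop :: "nat \<Rightarrow> nat \<Rightarrow> nat \<Rightarrow> (nat \<Rightarrow> complex) \<Rightarrow> (nat set \<Rightarrow> complex) \<Rightarrow> (nat set \<Rightarrow> complex)" where
  "kerop n r1 r2 lam \<psi> = (\<lambda>x2. if x2 \<in> Xr n r2 then (\<Sum>x1\<in>Xr n r1. lam (card (x2 - x1)) * \<psi> x1) else 0)"

definition Nmin :: "nat \<Rightarrow> nat \<Rightarrow> nat \<Rightarrow> nat" where
  "Nmin n r1 r2 = min (min r1 (n - r1)) (min r2 (n - r2))"

text \<open>lambda_s^{r1,r2}(t,n): the normalised polynomial (degree s, value 1 at 0) agreeing on
  max(0,r2-r1) <= k <= min(n-r1,r2) with the kernel of Lambda_s^{r1,r2}.\<close>
definition lambda_poly :: "nat \<Rightarrow> nat \<Rightarrow> nat \<Rightarrow> nat \<Rightarrow> complex poly" where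
  "lambda_poly n r1 r2 s = (THE p. degree p = s \<and> poly p 0 = 1 \<and>
     (\<exists>lam. (\<forall>k. r2 - r1 \<le> k \<and> k \<le> min (n - r1) r2 \<longrightarrow> lam k = poly p (of_nat k))
        \<and> (\<forall>\<psi>\<in>comp n r1 s. kerop n r1 r2 lam \<psi> \<in> comp n r2 s)
        \<and> (\<forall>\<psi>\<in>L2X n. (\<forall>\<phi>\<in>comp n r1 s. inner n \<psi> \<phi> = 0) \<longrightarrow> kerop n r1 r2 lam \<psi> = (\<lambda>_. 0))))"

definition ffall :: "complex \<Rightarrow> nat \<Rightarrow> complex" where
  "ffall a k = (\<Prod>i<k. a - of_nat i)"

end

theory Submission
  imports Defs "HOL-Computational_Algebra.Formal_Power_Series"
begin

text \<open>
  For \<open>\<phi>\<close> in the Specht module, the sums \<open>\<Sum>\<^sub>y (|x \<inter> y| choose j) \<phi>(y)\<close> vanish for \<open>j < s\<close>, so an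
  operator whose kernel depends only on \<open>|x \<inter> y|\<close> acts on \<open>\<phi>\<close> as a multiple of the map
  \<open>\<phi> \<mapsto> (x \<mapsto> \<Sum>\<^sub>y\<^sub>\<subseteq>\<^sub>x \<phi>(y))\<close>. Every equivariant map out of the Specht module has such a kernel; this is
  Schur's lemma for this representation, and it identifies the isotypic component of \<open>L\<^sup>2(X\<^sub>r)\<close> with
  the image of the Specht module under that map.

  The kernel polynomial \<open>p\<close> is then pinned down by \<open>p(0) = 1\<close> and \<open>\<Sum> p(|x\<^sub>2 - x\<^sub>1|) = 0\<close>, summed over the
  \<open>x\<^sub>1\<close> containing a given set \<open>z\<close> of \<open>s - 1\<close> points. In the Newton basis these sums are
  \<open>\<Sum>\<^sub>j c\<^sub>j (n-s+1-j choose r\<^sub>1-s+1) (|x\<^sub>2 - z| choose j)\<close>, and Vandermonde's identity shows that the stated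
  coefficients \<open>c\<^sub>j\<close> make them vanish.
\<close>

section \<open>Counting subsets\<close>

lemma finite_Xr [simp]: "finite (Xr n r)"
  by (rule finite_subset[of _ "Pow {0..<n}"]) (auto simp: Xr_def)

lemma finite_of_Xr: "x \<in> Xr n r \<Longrightarrow> finite x"
  by (auto simp: Xr_def intro: finite_subset)

text \<open>Removing \<open>z\<close> leaves an arbitrary set of \<open>r - card z\<close> points
  outside \<open>z\<close> and \<open>w\<close>. The bound \<open>card z \<le> r\<close> matters:
  for a larger \<open>z\<close> truncated subtraction would turn the count \<open>0\<close> into
  \<open>1\<close>. Sets confined to some \<open>x\<close> are counted by taking \<open>w\<close> as
  the complement of \<open>x\<close>.\<close>

lemma card_Xr_between:
  assumes "z \<subseteq> {0..<n}" "w \<subseteq> {0..<n}" "z \<inter> w = {}" "card z \<le> r"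
  shows "card {x \<in> Xr n r. z \<subseteq> x \<and> x \<inter> w = {}} = (n - card z - card w) choose (r - card z)"
proof -
  have fin: "finite z" "finite w"
    using assms finite_subset by blast+
  have "bij_betw (\<lambda>x. x - z) {x \<in> Xr n r. z \<subseteq> x \<and> x \<inter> w = {}}
      {y. y \<subseteq> {0..<n} - z - w \<and> card y = r - card z}"
  proof (rule bij_betw_byWitness[where f' = "\<lambda>y. y \<union> z"])
    show "(\<lambda>x. x - z) ` {x \<in> Xr n r. z \<subseteq> x \<and> x \<inter> w = {}}
      \<subseteq> {y. y \<subseteq> {0..<n} - z - w \<and> card y = r - card z}"
      using fin by (auto simp: Xr_def card_Diff_subset)
    have "card (y \<union> z) = r" if "y \<subseteq> {0..<n} - z - w" "card y = r - card z" for y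
    proof -
      have "finite y" "y \<inter> z = {}" using that finite_subset by blast+
      thus ?thesis using that fin assms by (simp add: card_Un_disjoint)
    qed
    thus "(\<lambda>y. y \<union> z) ` {y. y \<subseteq> {0..<n} - z - w \<and> card y = r - card z}
      \<subseteq> {x \<in> Xr n r. z \<subseteq> x \<and> x \<inter> w = {}}"
      using assms by (intro image_subsetI) (simp add: Xr_def, blast)
  qed auto
  moreover have "card ({0..<n} - z - w) = n - card z - card w"
  proof -
    have "{0..<n} - z - w = {0..<n} - (z \<union> w)" by auto
    thus ?thesis using assms fin by (simp add: card_Diff_subset card_Un_disjoint)
  qed
  ultimately show ?thesis
    by (simp add: bij_betw_same_card n_subsets)
qed

text \<open>Double counting: the binomial is the number of \<open>j\<close>-subsets of the related
  points, and the two sums are exchanged. A general \<open>R\<close> serves both intersections and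
  differences.\<close>

lemma sum_binomial_card_swap:
  fixes f :: "'b \<Rightarrow> complex"
  assumes "finite X" "finite Y"
  shows "(\<Sum>y\<in>Y. of_nat (card {a \<in> X. R y a} choose j) * f y) =
    (\<Sum>w | w \<subseteq> X \<and> card w = j. \<Sum>y\<in>{y \<in> Y. \<forall>a\<in>w. R y a}. f y)"
proof -
  let ?S = "{w. w \<subseteq> X \<and> card w = j}"
  have finS: "finite ?S" using assms by simp
  have "of_nat (card {a \<in> X. R y a} choose j) * f y
      = (\<Sum>w\<in>?S. if \<forall>a\<in>w. R y a then f y else 0)" for y
  proof -
    have "card {a \<in> X. R y a} choose j = card {w. w \<subseteq> {a \<in> X. R y a} \<and> card w = j}"
      using assms by (simp add: n_subsets)
    also have "{w. w \<subseteq> {a \<in> X. R y a} \<and> card w = j} = ?S \<inter> {w. \<forall>a\<in>w. R y a}" by auto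
    finally show ?thesis
      using finS by (simp add: sum.If_cases)
  qed
  hence "(\<Sum>y\<in>Y. of_nat (card {a \<in> X. R y a} choose j) * f y) =
    (\<Sum>y\<in>Y. \<Sum>w\<in>?S. if \<forall>a\<in>w. R y a then f y else 0)" by simp
  also have "\<dots> = (\<Sum>w\<in>?S. \<Sum>y\<in>Y. if \<forall>a\<in>w. R y a then f y else 0)"
    by (rule sum.swap)
  also have "\<dots> = (\<Sum>w\<in>?S. \<Sum>y\<in>{y \<in> Y. \<forall>a\<in>w. R y a}. f y)"
    using assms by (intro sum.cong[OF refl sum.inter_filter[symmetric]])
  finally show ?thesis .
qed

lemma Collect_mem_notin: "{a \<in> X. a \<in> Y} = X \<inter> Y" "{a \<in> X. a \<notin> Y} = X - Y"
  by auto

lemma sum_binomial_card_Int: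
  fixes f :: "'a set \<Rightarrow> complex"
  assumes "finite X" "finite Y"
  shows "(\<Sum>y\<in>Y. of_nat (card (X \<inter> y) choose j) * f y) =
    (\<Sum>w | w \<subseteq> X \<and> card w = j. \<Sum>y\<in>{y \<in> Y. w \<subseteq> y}. f y)"
  using sum_binomial_card_swap[OF assms, of "\<lambda>y a. a \<in> y" j f]
  by (simp add: Collect_mem_notin subset_eq)

lemma sum_binomial_card_Diff:
  fixes f :: "'a set \<Rightarrow> complex"
  assumes "finite X" "finite Y"
  shows "(\<Sum>y\<in>Y. of_nat (card (X - y) choose j) * f y) =
    (\<Sum>w | w \<subseteq> X \<and> card w = j. \<Sum>y\<in>{y \<in> Y. y \<inter> w = {}}. f y)"
proof -
  have "(\<forall>a\<in>w. a \<notin> y) \<longleftrightarrow> y \<inter> w = {}" for w y :: "'a set" by auto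
  thus ?thesis
    using sum_binomial_card_swap[OF assms, of "\<lambda>y a. a \<notin> y" j f]
    by (simp add: Collect_mem_notin)
qed

lemma card_Diff_plus_card_Int:
  assumes "x \<in> Xr n r"
  shows "card (x - y) + card (x \<inter> y) = r"
  using card_Int_Diff[OF finite_of_Xr[OF assms], of y] assms by (simp add: Xr_def)

section \<open>Newton expansions\<close>

definition newton_poly :: "nat \<Rightarrow> complex poly" where
  "newton_poly j = smult (inverse (fact j)) (\<Prod>i<j. [:- of_nat i, 1:])"

lemma poly_newton_poly: "poly (newton_poly j) t = t gchoose j"
  by (simp add: newton_poly_def poly_prod gbinomial_prod_rev field_simps atLeast0LessThan)

lemma poly_newton_poly_of_nat: "poly (newton_poly j) (of_nat k) = of_nat (k choose j)"
  by (simp add: poly_newton_poly binomial_gbinomial)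

lemma degree_newton_poly: "degree (newton_poly j) = j"
  by (simp add: newton_poly_def degree_prod_eq_sum_degree)

lemma coeff_newton_poly_self: "coeff (newton_poly j) j = inverse (fact j)"
proof -
  have "lead_coeff (newton_poly j) = inverse (fact j)"
    unfolding newton_poly_def lead_coeff_smult by (simp add: lead_coeff_prod)
  thus ?thesis by (simp add: degree_newton_poly)
qed

definition newton_sum :: "(nat \<Rightarrow> complex) \<Rightarrow> nat \<Rightarrow> complex poly" where
  "newton_sum c s = (\<Sum>j\<le>s. smult (c j) (newton_poly j))"

lemma poly_newton_sum: "poly (newton_sum c s) t = (\<Sum>j\<le>s. c j * (t gchoose j))"
  by (simp add: newton_sum_def poly_sum poly_newton_poly)

lemma poly_newton_sum_of_nat:
  "poly (newton_sum c s) (of_nat k) = (\<Sum>j\<le>s. c j * of_nat (k choose j))"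
  by (simp add: newton_sum_def poly_sum poly_newton_poly_of_nat)

lemma poly_newton_sum_0: "poly (newton_sum c s) 0 = c 0"
  using poly_newton_sum_of_nat[of c s 0]
  by (simp add: sum.atMost_shift)

lemma degree_newton_sum: "degree (newton_sum c s) \<le> s"
  unfolding newton_sum_def
  by (intro degree_sum_le) (auto simp: degree_newton_poly intro: order_trans[OF degree_smult_le])

lemma coeff_newton_sum: "coeff (newton_sum c s) s = c s / fact s"
proof -
  have "coeff (newton_sum c s) s = (\<Sum>j\<le>s. c j * coeff (newton_poly j) s)"
    by (simp add: newton_sum_def coeff_sum)
  also have "\<dots> = (\<Sum>j\<in>{s}. c j * coeff (newton_poly j) s)"
    by (rule sum.mono_neutral_right) (auto simp: coeff_eq_0 degree_newton_poly)
  finally show ?thesis by (simp add: coeff_newton_poly_self field_simps)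
qed

text \<open>The system is unitriangular: \<open>i choose Suc s\<close> is \<open>0\<close> for
  \<open>i \<le> s\<close> and \<open>1\<close> at \<open>Suc s\<close>, so the new coefficient
  corrects the new value and disturbs no earlier one.\<close>

lemma newton_interpolation: "\<exists>a. \<forall>i\<le>s. f i = (\<Sum>j\<le>s. a j * of_nat (i choose j) :: complex)"
proof (induction s)
  case 0
  show ?case by (rule exI[of _ f]) simp
next
  case (Suc s)
  then obtain a where a: "\<forall>i\<le>s. f i = (\<Sum>j\<le>s. a j * of_nat (i choose j))" by blast
  define b where "b = a(Suc s := f (Suc s) - (\<Sum>j\<le>s. a j * of_nat (Suc s choose j)))"
  have "(\<Sum>j\<le>s. b j * of_nat (i choose j)) = (\<Sum>j\<le>s. a j * of_nat (i choose j))" for i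
    by (rule sum.cong) (auto simp: b_def)
  hence "f i = (\<Sum>j\<le>Suc s. b j * of_nat (i choose j))" if "i \<le> Suc s" for i
    using that a by (cases "i = Suc s") (auto simp: b_def)
  thus ?case by blast
qed

lemma poly_zero_of_many_zeros:
  fixes p :: "complex poly"
  assumes "degree p < card A" "\<And>x. x \<in> A \<Longrightarrow> poly p x = 0"
  shows "p = 0"
proof (rule ccontr)
  assume p: "p \<noteq> 0"
  have "card A \<le> card {x. poly p x = 0}"
    using assms(2) p by (intro card_mono poly_roots_finite) auto
  also have "\<dots> \<le> degree p" using p by (rule card_poly_roots_bound)
  finally show False using assms(1) by simp
qed

text \<open>Interpolation at \<open>0, ..., s\<close> leaves a difference of degree at most
  \<open>s\<close> with \<open>s + 1\<close> zeros.\<close>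

lemma newton_expansion:
  assumes "degree p \<le> s"
  obtains c where "p = newton_sum c s"
proof -
  obtain c where c: "\<forall>i\<le>s. poly p (of_nat i) = (\<Sum>j\<le>s. c j * of_nat (i choose j))"
    using newton_interpolation[of s "\<lambda>i. poly p (of_nat i)"] by blast
  have "p - newton_sum c s = 0"
  proof (rule poly_zero_of_many_zeros[where A = "of_nat ` {..s}"])
    show "degree (p - newton_sum c s) < card (of_nat ` {..s} :: complex set)"
      using assms degree_newton_sum[of c s] degree_diff_le[of p s "newton_sum c s"]
      by (simp add: card_image inj_on_def)
    show "poly (p - newton_sum c s) x = 0" if "x \<in> of_nat ` {..s}" for x
      using that c by (auto simp: poly_newton_sum_of_nat)
  qed
  thus ?thesis using that by simp
qed

text \<open>Evaluation at \<open>k\<close> isolates \<open>c k\<close>: the earlier coefficients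
  vanish by induction, the later binomials are \<open>0\<close>.\<close>

lemma newton_sum_eq_0D:
  assumes "newton_sum c s = 0" "j \<le> s"
  shows "c j = 0"
  using assms(2)
proof (induction j rule: less_induct)
  case (less k)
  have "0 = (\<Sum>j\<le>s. c j * of_nat (k choose j))"
    using poly_newton_sum_of_nat[of c s k] assms(1) by simp
  also have "\<dots> = (\<Sum>j\<in>{k}. c j * of_nat (k choose j))"
  proof (rule sum.mono_neutral_right)
    show "\<forall>j\<in>{..s} - {k}. c j * of_nat (k choose j) = 0"
    proof
      fix j assume "j \<in> {..s} - {k}"
      thus "c j * of_nat (k choose j) = 0"
        using less by (cases "j < k") (auto simp: binomial_eq_0)
    qed
  qed (use less in auto)
  finally show ?case by simp
qed

section \<open>The Specht module\<close>

text \<open>The embedding of the Specht module into \<open>L2Xr n r\<close>, by the inclusion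
  kernel. The value \<open>0\<close> outside \<open>Xr n r\<close> keeps the image in that
  space.\<close>

definition up_map :: "nat \<Rightarrow> nat \<Rightarrow> nat \<Rightarrow> (nat set \<Rightarrow> complex) \<Rightarrow> nat set \<Rightarrow> complex" where
  "up_map n s r \<phi> = (\<lambda>x. if x \<in> Xr n r then \<Sum>y\<in>{y \<in> Xr n s. y \<subseteq> x}. \<phi> y else 0)"

text \<open>The definition covers sets of \<open>s - 1\<close> points. Summing its conditions over
  all such sets containing \<open>w\<close> counts each \<open>x\<close> exactly
  \<open>s - card w\<close> times, a nonzero factor.\<close>

lemma Specht_sum_supersets_eq_0:
  assumes "\<phi> \<in> Specht n s" "w \<subseteq> {0..<n}" "card w < s"
  shows "(\<Sum>x\<in>{x \<in> Xr n s. w \<subseteq> x}. \<phi> x) = 0"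
proof -
  let ?V = "{v \<in> Xr n (s - 1). w \<subseteq> v}" and ?X = "{x \<in> Xr n s. w \<subseteq> x}"
  have count: "card {v \<in> ?V. v \<subseteq> x} = s - card w" if "x \<in> ?X" for x
  proof -
    have "{v \<in> ?V. v \<subseteq> x} = {v \<in> Xr n (s - 1). w \<subseteq> v \<and> v \<inter> ({0..<n} - x) = {}}"
      by (auto simp: Xr_def)
    moreover have "card ({0..<n} - x) = n - s" "s \<le> n"
      using that card_mono[of "{0..<n}" x] by (auto simp: Xr_def card_Diff_subset finite_subset)
    \<comment> \<open>In this form the count is \<open>Suc m choose m\<close> with
      \<open>m = s - 1 - card w\<close>, which is \<open>Suc m = s - card w\<close>.\<close>
    moreover have "n - card w - (n - s) = Suc (s - 1 - card w)"
      using assms(3) \<open>s \<le> n\<close> by simp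
    moreover have "w \<inter> ({0..<n} - x) = {}" "card w \<le> s - 1"
      using that assms(3) by auto
    ultimately show ?thesis
      using card_Xr_between[of w n "{0..<n} - x" "s - 1"] assms(2,3) by simp
  qed
  have "0 = (\<Sum>v\<in>?V. \<Sum>x\<in>{x \<in> Xr n s. v \<subseteq> x}. \<phi> x)"
    using assms by (simp add: Specht_def)
  also have "\<dots> = (\<Sum>v\<in>?V. \<Sum>x\<in>{x \<in> ?X. v \<subseteq> x}. \<phi> x)"
    by (intro sum.cong) auto
  also have "\<dots> = (\<Sum>x\<in>?X. \<Sum>v\<in>{v \<in> ?V. v \<subseteq> x}. \<phi> x)"
    by (rule sum.swap_restrict) auto
  also have "\<dots> = of_nat (s - card w) * (\<Sum>x\<in>?X. \<phi> x)"
    using count by (simp add: sum_distrib_left)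
  finally show ?thesis using assms(3) by simp
qed

text \<open>The binomial counts the \<open>j\<close>-subsets \<open>w\<close> of
  \<open>x \<inter> y\<close>. For fixed \<open>w\<close> the sum over \<open>y\<close> vanishes if
  \<open>j < s\<close>, and if \<open>j = s\<close> only \<open>y = w\<close> contributes.\<close>

lemma Specht_binomial_kernel:
  assumes "\<phi> \<in> Specht n s" "x \<subseteq> {0..<n}" "j \<le> s"
  shows "(\<Sum>y\<in>Xr n s. of_nat (card (x \<inter> y) choose j) * \<phi> y) =
    (if j = s then \<Sum>y\<in>{y \<in> Xr n s. y \<subseteq> x}. \<phi> y else 0)"
proof -
  have fx: "finite x" using assms(2) finite_subset by blast
  have "(\<Sum>y\<in>Xr n s. of_nat (card (x \<inter> y) choose j) * \<phi> y) =
    (\<Sum>w | w \<subseteq> x \<and> card w = j. \<Sum>y\<in>{y \<in> Xr n s. w \<subseteq> y}. \<phi> y)"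
    by (rule sum_binomial_card_Int) (use fx in auto)
  also have "\<dots> = (if j = s then \<Sum>y\<in>{y \<in> Xr n s. y \<subseteq> x}. \<phi> y else 0)"
  proof (cases "j = s")
    case True
    have "{y \<in> Xr n s. w \<subseteq> y} = {w}" if "w \<subseteq> x" "card w = s" for w
    proof -
      have "w = y" if "y \<in> Xr n s" "w \<subseteq> y" for y
        using card_subset_eq[OF finite_of_Xr that(2)] that \<open>card w = s\<close> by (auto simp: Xr_def)
      thus ?thesis using that assms(2) by (auto simp: Xr_def)
    qed
    hence "(\<Sum>w | w \<subseteq> x \<and> card w = s. \<Sum>y\<in>{y \<in> Xr n s. w \<subseteq> y}. \<phi> y)
      = (\<Sum>w | w \<subseteq> x \<and> card w = s. \<phi> w)"
      by (intro sum.cong[OF refl]) simp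
    moreover have "{w. w \<subseteq> x \<and> card w = s} = {y \<in> Xr n s. y \<subseteq> x}"
      using assms(2) by (auto simp: Xr_def)
    ultimately show ?thesis using True by simp
  next
    case False
    have "(\<Sum>y\<in>{y \<in> Xr n s. w \<subseteq> y}. \<phi> y) = 0" if "w \<subseteq> x" "card w = j" for w
      using False that assms by (intro Specht_sum_supersets_eq_0) auto
    thus ?thesis using False by simp
  qed
  finally show ?thesis .
qed

text \<open>Only the top Newton coefficient survives. As \<open>card (x \<inter> y) \<le> s\<close>,
  an expansion of \<open>f\<close> on \<open>0, ..., s\<close> suffices, and interpolation supplies
  one for every \<open>f\<close>.\<close>

lemma Specht_kernel:
  assumes "\<phi> \<in> Specht n s" "x \<subseteq> {0..<n}"
    and f: "\<And>i. i \<le> s \<Longrightarrow> f i = (\<Sum>j\<le>s. a j * of_nat (i choose j))"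
  shows "(\<Sum>y\<in>Xr n s. f (card (x \<inter> y)) * \<phi> y) = a s * (\<Sum>y\<in>{y \<in> Xr n s. y \<subseteq> x}. \<phi> y)"
proof -
  have "card (x \<inter> y) \<le> s" if "y \<in> Xr n s" for y
    using card_mono[OF finite_of_Xr[OF that], of "x \<inter> y"] that by (auto simp: Xr_def)
  hence "(\<Sum>y\<in>Xr n s. f (card (x \<inter> y)) * \<phi> y)
    = (\<Sum>y\<in>Xr n s. \<Sum>j\<le>s. a j * (of_nat (card (x \<inter> y) choose j) * \<phi> y))"
    by (intro sum.cong refl) (simp add: f sum_distrib_right mult.assoc)
  also have "\<dots> = (\<Sum>j\<le>s. a j * (\<Sum>y\<in>Xr n s. of_nat (card (x \<inter> y) choose j) * \<phi> y))"
    by (subst sum.swap) (simp add: sum_distrib_left)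
  also have "\<dots> = (\<Sum>j\<le>s. a j * (if j = s then \<Sum>y\<in>{y \<in> Xr n s. y \<subseteq> x}. \<phi> y else 0))"
    using assms by (intro sum.cong refl) (simp add: Specht_binomial_kernel)
  also have "\<dots> = a s * (\<Sum>y\<in>{y \<in> Xr n s. y \<subseteq> x}. \<phi> y)"
    by (subst sum.remove[of _ s]) (auto intro!: sum.neutral)
  finally show ?thesis .
qed

text \<open>The number of \<open>x\<close> containing \<open>z \<union> y\<close> depends only on
  \<open>card (z \<inter> y)\<close>, so \<open>Specht_kernel\<close> leaves a multiple of the sum
  over \<open>y \<subseteq> z\<close>. That sum is empty since \<open>z\<close> has only
  \<open>s - 1\<close> points.\<close>

lemma up_map_sum_supersets_eq_0:
  assumes "\<phi> \<in> Specht n s" "s \<ge> 1" "z \<in> Xr n (s - 1)"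
  shows "(\<Sum>x\<in>{x \<in> Xr n r. z \<subseteq> x}. up_map n s r \<phi> x) = 0"
proof -
  \<comment> \<open>\<open>2 * s - 1 - i\<close> is the size of \<open>z \<union> y\<close> when the
    intersection has \<open>i\<close> points. The zero branch handles unions too large for
    \<open>r\<close>, where the binomial would be \<open>1\<close>.\<close>
  define f where "f i = (if 2 * s - 1 - i \<le> r
    then of_nat ((n - (2 * s - 1 - i)) choose (r - (2 * s - 1 - i))) else 0 :: complex)" for i
  have count: "of_nat (card {x \<in> Xr n r. z \<subseteq> x \<and> y \<subseteq> x}) = f (card (z \<inter> y))"
    if y: "y \<in> Xr n s" for y
  proof -
    have un: "card (z \<union> y) = 2 * s - 1 - card (z \<inter> y)"
      using card_Un_Int[OF finite_of_Xr[OF assms(3)] finite_of_Xr[OF y]] assms y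
      by (simp add: Xr_def)
    show ?thesis
    proof (cases "card (z \<union> y) \<le> r")
      case True
      have "z \<union> y \<subseteq> {0..<n}" using y assms by (auto simp: Xr_def)
      from card_Xr_between[OF this _ _ True, of "{}"] show ?thesis
        using True by (simp add: f_def un)
    next
      case False
      have "{x \<in> Xr n r. z \<subseteq> x \<and> y \<subseteq> x} = {}"
      proof -
        have "\<not> z \<union> y \<subseteq> x" if "x \<in> Xr n r" for x
          using card_mono[OF finite_of_Xr[OF that], of "z \<union> y"] that False by (auto simp: Xr_def)
        thus ?thesis by auto
      qed
      thus ?thesis using False by (simp add: f_def un)
    qed
  qed
  obtain a where a: "\<forall>i\<le>s. f i = (\<Sum>j\<le>s. a j * of_nat (i choose j))"
    using newton_interpolation by blast
  have "(\<Sum>x\<in>{x \<in> Xr n r. z \<subseteq> x}. up_map n s r \<phi> x)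
    = (\<Sum>x\<in>{x \<in> Xr n r. z \<subseteq> x}. \<Sum>y\<in>{y \<in> Xr n s. y \<subseteq> x}. \<phi> y)"
    by (simp add: up_map_def)
  also have "\<dots> = (\<Sum>y\<in>Xr n s. \<Sum>x\<in>{x \<in> {x \<in> Xr n r. z \<subseteq> x}. y \<subseteq> x}. \<phi> y)"
    by (rule sum.swap_restrict) auto
  also have "\<dots> = (\<Sum>y\<in>Xr n s. f (card (z \<inter> y)) * \<phi> y)"
    by (intro sum.cong refl) (simp add: count conj_assoc)
  also have "\<dots> = a s * (\<Sum>y\<in>{y \<in> Xr n s. y \<subseteq> z}. \<phi> y)"
    by (rule Specht_kernel) (use a assms in \<open>auto simp: Xr_def\<close>)
  also have "{y \<in> Xr n s. y \<subseteq> z} = {}"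
  proof -
    have "\<not> y \<subseteq> z" if "y \<in> Xr n s" for y
      using card_mono[OF finite_of_Xr[OF assms(3)], of y] assms that by (auto simp: Xr_def)
    thus ?thesis by auto
  qed
  finally show ?thesis by simp
qed

text \<open>This inverts \<open>up_map\<close> up to a scalar. An \<open>x\<close> containing
  \<open>y\<close> and avoiding \<open>z\<close> exists only if \<open>y\<close> and
  \<open>z\<close> are disjoint, so the kernel is a multiple of the indicator of
  \<open>card (z \<inter> y) = 0\<close>.\<close>

lemma up_map_disjoint_sum:
  assumes "\<phi> \<in> Specht n s" "s \<le> r" "s \<le> n - r" "r \<le> n" "z \<in> Xr n s"
  shows "(\<Sum>x\<in>{x \<in> Xr n r. x \<inter> z = {}}. up_map n s r \<phi> x)
    = of_nat ((n - 2 * s) choose (r - s)) * (-1) ^ s * \<phi> z"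
proof -
  define f where "f i = (if i = 0 then of_nat ((n - 2 * s) choose (r - s)) else 0 :: complex)"
    for i :: nat
  \<comment> \<open>The indicator of \<open>i = 0\<close> has Newton coefficients
    \<open>(-1) ^ j\<close>, because alternating binomial sums vanish for
    \<open>i > 0\<close>.\<close>
  have f: "f i = (\<Sum>j\<le>s. of_nat ((n - 2 * s) choose (r - s)) * (-1) ^ j * of_nat (i choose j))"
    if "i \<le> s" for i
  proof -
    have "(\<Sum>j\<le>s. (-1) ^ j * of_nat (i choose j)) = (\<Sum>j\<le>i. (-1) ^ j * of_nat (i choose j) :: complex)"
      by (rule sum.mono_neutral_right) (use that in auto)
    also have "\<dots> = (if i = 0 then 1 else 0)"
      using choose_alternating_sum[of i, where ?'a = complex] by auto
    finally show ?thesis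
      by (simp add: f_def mult.assoc flip: sum_distrib_left)
  qed
  have count: "of_nat (card {x \<in> Xr n r. x \<inter> z = {} \<and> y \<subseteq> x}) = f (card (z \<inter> y))"
    if y: "y \<in> Xr n s" for y
  proof (cases "z \<inter> y = {}")
    case True
    have "{x \<in> Xr n r. x \<inter> z = {} \<and> y \<subseteq> x} = {x \<in> Xr n r. y \<subseteq> x \<and> x \<inter> z = {}}" by auto
    thus ?thesis
      using card_Xr_between[of y n z r] True assms y by (auto simp: Xr_def f_def mult_2)
  next
    case False
    hence "{x \<in> Xr n r. x \<inter> z = {} \<and> y \<subseteq> x} = {}" by auto
    thus ?thesis using False finite_of_Xr[OF y] unfolding f_def by simp
  qed
  have "(\<Sum>x\<in>{x \<in> Xr n r. x \<inter> z = {}}. up_map n s r \<phi> x)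
    = (\<Sum>x\<in>{x \<in> Xr n r. x \<inter> z = {}}. \<Sum>y\<in>{y \<in> Xr n s. y \<subseteq> x}. \<phi> y)"
    by (simp add: up_map_def)
  also have "\<dots> = (\<Sum>y\<in>Xr n s. \<Sum>x\<in>{x \<in> {x \<in> Xr n r. x \<inter> z = {}}. y \<subseteq> x}. \<phi> y)"
    by (rule sum.swap_restrict) auto
  also have "\<dots> = (\<Sum>y\<in>Xr n s. f (card (z \<inter> y)) * \<phi> y)"
    by (intro sum.cong refl) (simp add: count conj_assoc)
  also have "\<dots> = of_nat ((n - 2 * s) choose (r - s)) * (-1) ^ s * (\<Sum>y\<in>{y \<in> Xr n s. y \<subseteq> z}. \<phi> y)"
    by (rule Specht_kernel) (use f assms in \<open>auto simp: Xr_def\<close>)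
  also have "{y \<in> Xr n s. y \<subseteq> z} = {z}"
    using card_subset_eq[OF finite_of_Xr[OF assms(5)]] assms by (auto simp: Xr_def)
  finally show ?thesis by simp
qed

lemma Specht_eq_0_outside: "\<phi> \<in> Specht n s \<Longrightarrow> x \<notin> Xr n s \<Longrightarrow> \<phi> x = 0"
  by (auto simp: Specht_def L2Xr_def)

lemma inj_on_up_map:
  assumes "s \<le> r" "s \<le> n - r" "r \<le> n"
  shows "inj_on (up_map n s r) (Specht n s)"
proof (rule inj_onI, rule ext)
  fix \<phi> \<psi> z assume *: "\<phi> \<in> Specht n s" "\<psi> \<in> Specht n s" "up_map n s r \<phi> = up_map n s r \<psi>"
  show "\<phi> z = \<psi> z"
  proof (cases "z \<in> Xr n s")
    case True
    have "(n - 2 * s) choose (r - s) \<noteq> 0" using assms by (simp add: binomial_eq_0_iff)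
    thus ?thesis
      using up_map_disjoint_sum[OF *(1) assms True] up_map_disjoint_sum[OF *(2) assms True] *(3)
      by simp
  qed (use * in \<open>simp add: Specht_eq_0_outside\<close>)
qed

section \<open>The difference kernels annihilating lower degrees\<close>

text \<open>Newton coefficients of the Hahn polynomial 3F2(-t, -s, s-n-1; r1-n, -r2; 1).\<close>

definition hahn_coeff :: "nat \<Rightarrow> nat \<Rightarrow> nat \<Rightarrow> nat \<Rightarrow> nat \<Rightarrow> complex" where
  "hahn_coeff n r1 r2 s j = (-1) ^ j * (ffall (of_nat s) j * ffall (of_nat n - of_nat s + 1) j)
     / (ffall (of_nat n - of_nat r1) j * ffall (of_nat r2) j)"

definition hahn_poly :: "nat \<Rightarrow> nat \<Rightarrow> nat \<Rightarrow> nat \<Rightarrow> complex poly" where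
  "hahn_poly n r1 r2 s = newton_sum (hahn_coeff n r1 r2 s) s"

lemma ffall_gbinomial: "ffall a j = fact j * (a gchoose j)"
  by (simp add: ffall_def gbinomial_mult_fact atLeast0LessThan)

lemma ffall_of_nat:
  assumes "j \<le> m"
  shows "ffall (of_nat m) j = fact m / fact (m - j)"
proof -
  have "ffall (of_nat m) j = fact j * of_nat (m choose j)"
    by (simp add: ffall_gbinomial binomial_gbinomial)
  also have "\<dots> = fact m / fact (m - j)"
    using assms by (simp add: binomial_fact)
  finally show ?thesis .
qed

lemma hahn_coeff_fact:
  assumes "s \<le> r1" "s \<le> n - r1" "r1 \<le> n" "s \<le> r2" "j \<le> s"
  shows "hahn_coeff n r1 r2 s j = (-1) ^ j * (fact s / fact (s - j)) *
    (fact (n - s + 1) / fact (n - s + 1 - j)) *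
    (fact (n - r1 - j) / fact (n - r1)) * (fact (r2 - j) / fact r2)"
proof -
  have "of_nat n - of_nat s + 1 = (of_nat (n - s + 1) :: complex)"
    "of_nat n - of_nat r1 = (of_nat (n - r1) :: complex)"
    using assms by (simp_all add: of_nat_diff)
  hence "ffall (of_nat n - of_nat s + 1) j = fact (n - s + 1) / fact (n - s + 1 - j)"
    "ffall (of_nat n - of_nat r1) j = fact (n - r1) / fact (n - r1 - j)"
    using assms by (simp_all only:) (intro ffall_of_nat; simp)+
  thus ?thesis
    using assms by (simp add: hahn_coeff_def ffall_of_nat mult_ac del: fact_Suc)
qed

lemma poly_hahn_poly_0 [simp]: "poly (hahn_poly n r1 r2 s) 0 = 1"
  by (simp add: hahn_poly_def poly_newton_sum_0 hahn_coeff_def ffall_def)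

lemma coeff_hahn_poly: "coeff (hahn_poly n r1 r2 s) s = hahn_coeff n r1 r2 s s / fact s"
  by (simp add: hahn_poly_def coeff_newton_sum)

lemma degree_hahn_poly:
  assumes "s \<le> r1" "s \<le> n - r1" "r1 \<le> n" "s \<le> r2"
  shows "degree (hahn_poly n r1 r2 s) = s"
proof (rule antisym)
  have "coeff (hahn_poly n r1 r2 s) s \<noteq> 0"
    using hahn_coeff_fact[OF assms order_refl] by (simp add: coeff_hahn_poly del: fact_Suc)
  thus "s \<le> degree (hahn_poly n r1 r2 s)" by (rule le_degree)
qed (simp add: hahn_poly_def degree_newton_sum)

text \<open>The left binomial is the weight arising in superset sums. The product is, up to a factor
  free of \<open>j\<close>, the second factor of a Vandermonde convolution; negating the upper
  argument turns it into \<open>(-1) ^ (s - j)\<close> times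
  \<open>(r2 - j) choose (s - j)\<close>.\<close>

lemma hahn_coeff_times_binomial:
  assumes "s \<ge> 1" "s \<le> r1" "s \<le> n - r1" "r1 \<le> n" "s \<le> r2" "j \<le> s"
  shows "hahn_coeff n r1 r2 s j * of_nat ((n - (s - 1) - j) choose (r1 - (s - 1))) =
    (-1) ^ s * of_nat ((n - (s - 1)) choose (r1 - (s - 1))) / of_nat (r2 choose s) *
      ((of_nat s - 1 - of_nat r2) gchoose (s - j))"
proof -
  have "((of_nat s - 1 - of_nat r2 :: complex) gchoose (s - j))
      = (-1) ^ (s - j) * (of_nat (r2 - j) gchoose (s - j))"
    using assms by (subst gbinomial_negated_upper) (simp add: of_nat_diff)
  hence g: "((of_nat s - 1 - of_nat r2 :: complex) gchoose (s - j))
      = (-1) ^ (s - j) * (fact (r2 - j) / (fact (s - j) * fact (r2 - s)))"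
    using assms binomial_fact[of "s - j" "r2 - j", where ?'a = complex]
    by (simp add: binomial_gbinomial)
  have sgn: "(-1) ^ s * (-1) ^ (s - j) = ((-1) ^ j :: complex)"
  proof -
    have "(-1) ^ s = ((-1) ^ (s - j) * (-1) ^ j :: complex)"
      using assms by (simp flip: power_add)
    thus ?thesis by (simp add: mult_ac flip: power_mult_distrib)
  qed
  have b1: "of_nat ((n - (s - 1) - j) choose (r1 - (s - 1)))
      = (fact (n - s + 1 - j) / (fact (r1 - (s - 1)) * fact (n - r1 - j)) :: complex)"
  proof -
    have "n - (s - 1) - j = n - s + 1 - j" "n - s + 1 - j - (r1 - (s - 1)) = n - r1 - j"
      "r1 - (s - 1) \<le> n - (s - 1) - j"
      using assms by auto
    thus ?thesis by (simp add: binomial_fact)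
  qed
  have b2: "of_nat ((n - (s - 1)) choose (r1 - (s - 1)))
      = (fact (n - s + 1) / (fact (r1 - (s - 1)) * fact (n - r1)) :: complex)"
  proof -
    have "n - (s - 1) = n - s + 1" "n - s + 1 - (r1 - (s - 1)) = n - r1"
      and "r1 - (s - 1) \<le> n - s + 1"
      using assms by auto
    thus ?thesis by (simp only: binomial_fact)
  qed
  have b3: "of_nat (r2 choose s) = (fact r2 / (fact s * fact (r2 - s)) :: complex)"
    using assms by (simp add: binomial_fact)
  show ?thesis
    unfolding hahn_coeff_fact[OF assms(2-6)] g b1 b2 b3 sgn[symmetric]
    by (simp add: field_simps)
qed

text \<open>\<open>card (x2 - x1) choose j\<close> counts the \<open>j\<close>-subsets
  \<open>w\<close> of \<open>x2\<close> that avoid \<open>x1\<close>. An \<open>x1\<close>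
  containing \<open>z\<close> can avoid \<open>w\<close> only if \<open>w\<close> misses
  \<open>z\<close>, and the number of such \<open>x1\<close> depends on \<open>j\<close>
  alone.\<close>

lemma sum_supersets_newton_sum:
  assumes "s \<ge> 1" "s \<le> r1" "z \<in> Xr n (s - 1)" "x2 \<in> Xr n r2"
  shows "(\<Sum>x1\<in>{x1 \<in> Xr n r1. z \<subseteq> x1}. poly (newton_sum c s) (of_nat (card (x2 - x1)))) =
    poly (newton_sum (\<lambda>j. c j * of_nat ((n - (s - 1) - j) choose (r1 - (s - 1)))) s)
      (of_nat (card (x2 - z)))"
proof -
  let ?Y = "{x1 \<in> Xr n r1. z \<subseteq> x1}" and ?d = "\<lambda>j. (n - (s - 1) - j) choose (r1 - (s - 1))"
  have fx2: "finite x2" by (rule finite_of_Xr[OF assms(4)])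
  have inner: "(\<Sum>x1\<in>?Y. of_nat (card (x2 - x1) choose j) :: complex)
      = of_nat (?d j) * of_nat (card (x2 - z) choose j)" for j
  proof -
    have cnt: "card {x1 \<in> ?Y. x1 \<inter> w = {}} = (if w \<subseteq> x2 - z then ?d j else 0)"
      if "w \<subseteq> x2" "card w = j" for w
    proof (cases "w \<inter> z = {}")
      case True
      have "{x1 \<in> ?Y. x1 \<inter> w = {}} = {x1 \<in> Xr n r1. z \<subseteq> x1 \<and> x1 \<inter> w = {}}" by auto
      moreover have "card {x1 \<in> Xr n r1. z \<subseteq> x1 \<and> x1 \<inter> w = {}} = ?d j"
      proof -
        have "z \<subseteq> {0..<n}" "w \<subseteq> {0..<n}" "z \<inter> w = {}" "card z = s - 1"
          using True assms that by (auto simp: Xr_def)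
        thus ?thesis using card_Xr_between[of z n w r1] assms(2) that(2) by simp
      qed
      ultimately show ?thesis using True that by auto
    next
      case False
      hence "{x1 \<in> ?Y. x1 \<inter> w = {}} = {}" by blast
      thus ?thesis using False by auto
    qed
    have "(\<Sum>x1\<in>?Y. of_nat (card (x2 - x1) choose j) :: complex)
        = (\<Sum>w | w \<subseteq> x2 \<and> card w = j. \<Sum>x1\<in>{x1 \<in> ?Y. x1 \<inter> w = {}}. 1)"
      using sum_binomial_card_Diff[OF fx2, of ?Y j "\<lambda>_. 1"] by simp
    also have "\<dots> = (\<Sum>w | w \<subseteq> x2 \<and> card w = j. if w \<subseteq> x2 - z then of_nat (?d j) else 0)"
    proof (rule sum.cong[OF refl])
      fix w assume "w \<in> {w. w \<subseteq> x2 \<and> card w = j}"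
      hence "card {x1 \<in> ?Y. x1 \<inter> w = {}} = (if w \<subseteq> x2 - z then ?d j else 0)"
        by (intro cnt) auto
      thus "(\<Sum>x1\<in>{x1 \<in> ?Y. x1 \<inter> w = {}}. 1)
          = (if w \<subseteq> x2 - z then of_nat (?d j) else 0 :: complex)"
        by (simp only: sum_constant mult_1_right) simp
    qed
    also have "\<dots> = (\<Sum>w\<in>{w. w \<subseteq> x2 - z \<and> card w = j}. of_nat (?d j))"
    proof -
      have "{w \<in> {w. w \<subseteq> x2 \<and> card w = j}. w \<subseteq> x2 - z} = {w. w \<subseteq> x2 - z \<and> card w = j}"
        by auto
      moreover have "finite {w. w \<subseteq> x2 \<and> card w = j}" using fx2 by simp
      ultimately show ?thesis by (simp only: sum.inter_filter[symmetric])
    qed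
    also have "\<dots> = of_nat (?d j) * of_nat (card (x2 - z) choose j)"
      using fx2 by (simp add: n_subsets)
    finally show ?thesis .
  qed
  have "(\<Sum>x1\<in>?Y. poly (newton_sum c s) (of_nat (card (x2 - x1))))
      = (\<Sum>j\<le>s. c j * (\<Sum>x1\<in>?Y. of_nat (card (x2 - x1) choose j)))"
    unfolding poly_newton_sum_of_nat by (subst sum.swap) (simp add: sum_distrib_left)
  thus ?thesis by (simp add: inner poly_newton_sum_of_nat mult.assoc)
qed

text \<open>Vandermonde sums the series to a multiple of \<open>m choose s\<close> with
  \<open>m = s - 1 - card (x2 \<inter> z)\<close>. This is zero because \<open>m\<close> is a
  natural number below \<open>s\<close>.\<close>

lemma hahn_poly_sum_supersets_eq_0:
  assumes "s \<ge> 1" "s \<le> r1" "s \<le> n - r1" "r1 \<le> n" "s \<le> r2" "z \<in> Xr n (s - 1)" "x2 \<in> Xr n r2"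
  shows "(\<Sum>x1\<in>{x1 \<in> Xr n r1. z \<subseteq> x1}. poly (hahn_poly n r1 r2 s) (of_nat (card (x2 - x1)))) = 0"
proof -
  define K :: complex
    where "K = (-1) ^ s * of_nat ((n - (s - 1)) choose (r1 - (s - 1))) / of_nat (r2 choose s)"
  have le: "card (x2 \<inter> z) \<le> s - 1"
    using card_mono[OF finite_of_Xr[OF assms(6)], of "x2 \<inter> z"] assms(6) by (auto simp: Xr_def)
  have card: "of_nat (card (x2 - z)) = (of_nat r2 - of_nat (card (x2 \<inter> z)) :: complex)"
    by (simp flip: card_Diff_plus_card_Int[OF assms(7), of z])
  have "(\<Sum>x1\<in>{x1 \<in> Xr n r1. z \<subseteq> x1}. poly (hahn_poly n r1 r2 s) (of_nat (card (x2 - x1))))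
      = (\<Sum>j\<le>s. hahn_coeff n r1 r2 s j * of_nat ((n - (s - 1) - j) choose (r1 - (s - 1)))
          * (of_nat (card (x2 - z)) gchoose j))"
    unfolding hahn_poly_def sum_supersets_newton_sum[OF assms(1,2,6,7)]
    by (simp only: poly_newton_sum)
  also have "\<dots> = (\<Sum>j\<le>s. K * ((of_nat (card (x2 - z)) gchoose j)
      * ((of_nat s - 1 - of_nat r2) gchoose (s - j))))"
    using hahn_coeff_times_binomial[OF assms(1-5)]
    by (intro sum.cong refl) (simp add: K_def)
  also have "\<dots> = K * ((of_nat (card (x2 - z)) + (of_nat s - 1 - of_nat r2)) gchoose s)"
    by (simp add: gbinomial_Vandermonde atMost_atLeast0 flip: sum_distrib_left)
  also have "of_nat (card (x2 - z)) + (of_nat s - 1 - of_nat r2)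
      = (of_nat (s - 1 - card (x2 \<inter> z)) :: complex)"
    using le assms(1) by (simp add: card of_nat_diff)
  also have "(of_nat (s - 1 - card (x2 \<inter> z)) gchoose s) = (0 :: complex)"
    using assms(1) by (simp flip: binomial_gbinomial)
  finally show ?thesis by simp
qed

text \<open>With \<open>p = \<Sum>\<^sub>j c\<^sub>j (t choose j)\<close>, the sums over the supersets of \<open>z\<close> are the values at
  \<open>|x\<^sub>2 - z|\<close> of a polynomial of degree at most \<open>s\<close> whose Newton coefficients are nonzero multiples
  of the \<open>c\<^sub>j\<close>. The \<open>s\<close> possible values of \<open>|x\<^sub>2 - z|\<close> together with \<open>0\<close> are \<open>s + 1\<close> roots.\<close>

lemma poly_eq_0_of_sum_supersets:
  fixes p :: "complex poly"
  assumes "degree p \<le> s" "poly p 0 = 0"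
    and "s \<le> r1" "s \<le> n - r1" "r1 \<le> n" "s \<le> r2" "s \<le> n - r2" "r2 \<le> n"
    and sums: "\<And>z x2. s \<ge> 1 \<Longrightarrow> z \<in> Xr n (s - 1) \<Longrightarrow> x2 \<in> Xr n r2 \<Longrightarrow>
      (\<Sum>x1\<in>{x1 \<in> Xr n r1. z \<subseteq> x1}. poly p (of_nat (card (x2 - x1)))) = 0"
  shows "p = 0"
proof (cases "s = 0")
  case True
  thus ?thesis using assms(1,2) by (auto elim!: degree_eq_zeroE)
next
  case False
  hence s1: "s \<ge> 1" by simp
  obtain c where c: "p = newton_sum c s" using newton_expansion[OF assms(1)] .
  let ?d = "\<lambda>j. of_nat ((n - (s - 1) - j) choose (r1 - (s - 1))) :: complex"
  define q where "q = newton_sum (\<lambda>j. c j * ?d j) s"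
  define A where "A = insert 0 ((\<lambda>i. r2 - i) ` {..<s})"
  have "q = 0"
  proof (rule poly_zero_of_many_zeros[where A = "of_nat ` A"])
    have "card A = Suc s"
    proof -
      have "inj_on (\<lambda>i. r2 - i) {..<s}" using assms(6) by (auto simp: inj_on_def)
      moreover have "0 \<notin> (\<lambda>i. r2 - i) ` {..<s}" using assms(6) by auto
      ultimately show ?thesis by (simp add: A_def card_image)
    qed
    thus "degree q < card (of_nat ` A :: complex set)"
      using degree_newton_sum[of _ s] by (simp add: card_image inj_on_def q_def less_Suc_eq_le)
    have "poly q (of_nat (r2 - i)) = 0" if "i < s" for i
    proof -
      \<comment> \<open>\<open>?z\<close> has \<open>i\<close> points inside \<open>?x\<close> and
        \<open>s - 1 - i\<close> outside; \<open>s \<le> n - r2\<close> leaves room for the latter.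
        Hence \<open>?x - ?z\<close> has \<open>r2 - i\<close> points.\<close>
      let ?z = "{0..<i} \<union> {r2..<r2 + (s - 1 - i)}" and ?x = "{0..<r2}"
      have "card ?z = s - 1"
        using that assms by (subst card_Un_disjoint) auto
      hence z: "?z \<in> Xr n (s - 1)" using that assms by (auto simp: Xr_def)
      have x: "?x \<in> Xr n r2" using assms by (auto simp: Xr_def)
      have "?x - ?z = {i..<r2}" using that assms by auto
      hence "card (?x - ?z) = r2 - i" by simp
      thus ?thesis
        using sums[OF s1 z x] sum_supersets_newton_sum[OF s1 assms(3) z x, of c]
        by (simp add: q_def c)
    qed
    moreover have "poly q 0 = 0"
      using assms(2) by (simp add: q_def c poly_newton_sum_0)
    ultimately show "poly q x = 0" if "x \<in> of_nat ` A" for x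
      using that by (auto simp: A_def)
  qed
  have "c j = 0" if "j \<le> s" for j
  proof -
    have "c j * ?d j = 0"
      by (rule newton_sum_eq_0D[OF _ that]) (use \<open>q = 0\<close> q_def in simp)
    \<comment> \<open>The binomial is nonzero since \<open>j \<le> s \<le> n - r1\<close>.\<close>
    moreover have "?d j \<noteq> 0" using that assms s1 by (simp add: binomial_eq_0_iff)
    ultimately show ?thesis by simp
  qed
  thus ?thesis by (simp add: c newton_sum_def)
qed

section \<open>The reproducing kernel of the Specht module\<close>

text \<open>Kernels are given in \<open>card (x - y)\<close>, whereas \<open>Specht_kernel\<close>
  works with \<open>card (x \<inter> y)\<close>. The reflection between them preserves the degree,
  so the top Newton coefficient stays nonzero.\<close>

lemma newton_expansion_reflected:
  fixes p :: "complex poly"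
  assumes "degree p = s" "p \<noteq> 0"
  obtains a where "a s \<noteq> 0" "\<And>t. poly p (c - t) = poly (newton_sum a s) t"
proof -
  define q where "q = pcompose p [:c, -1:]"
  have dq: "degree q = s" using assms by (simp add: q_def degree_pcompose)
  then obtain a where a: "q = newton_sum a s" using newton_expansion[of q s] by auto
  have "poly p (c - t) = poly q t" for t by (simp add: q_def poly_pcompose)
  moreover have "a s \<noteq> 0"
  proof
    assume "a s = 0"
    hence "lead_coeff q = 0" using coeff_newton_sum[of a s] a dq by simp
    hence "q = 0" by simp
    thus False using assms pcompose_eq_0[of p "[:c, -1:]"] by (simp add: q_def)
  qed
  ultimately show ?thesis using that a by simp
qed

lemma hahn_poly_neq_0: "hahn_poly n r1 r2 s \<noteq> 0"
  by (metis poly_0 poly_hahn_poly_0 zero_neq_one)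

text \<open>The case \<open>r1 = s\<close> with \<open>x\<close> fixed, read as a function of
  \<open>y\<close>: an explicit supply of elements of the Specht module.\<close>

definition hahn_kernel :: "nat \<Rightarrow> nat \<Rightarrow> nat \<Rightarrow> nat set \<Rightarrow> nat set \<Rightarrow> complex" where
  "hahn_kernel n r2 s x = (\<lambda>y. if y \<in> Xr n s then poly (hahn_poly n s r2 s) (of_nat (card (x - y))) else 0)"

lemma hahn_kernel_in_Specht:
  assumes "2 * s \<le> n" "s \<le> r2" "x \<in> Xr n r2"
  shows "hahn_kernel n r2 s x \<in> Specht n s"
proof -
  have "(\<Sum>y\<in>{y \<in> Xr n s. z \<subseteq> y}. hahn_kernel n r2 s x y) = 0" if "s \<ge> 1" "z \<in> Xr n (s - 1)" for z
    using hahn_poly_sum_supersets_eq_0[OF that(1) order_refl _ _ assms(2) that(2) assms(3)] assms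
    by (simp add: hahn_kernel_def)
  thus ?thesis by (auto simp: Specht_def L2Xr_def hahn_kernel_def)
qed

text \<open>By \<open>Specht_kernel\<close> the operator is a nonzero multiple of summation over
  \<open>y \<subseteq> x\<close>, and for \<open>card x = s\<close> only \<open>y = x\<close>
  remains. In particular the kernels span the Specht module.\<close>

lemma hahn_kernel_reproducing:
  assumes "2 * s \<le> n"
  obtains a where "a \<noteq> 0"
    "\<And>\<phi> x. \<phi> \<in> Specht n s \<Longrightarrow> (\<Sum>y\<in>Xr n s. \<phi> y * hahn_kernel n s s y x) = a * \<phi> x"
proof -
  have le: "s \<le> n - s" "s \<le> n" using assms by simp_all
  obtain a where a: "a s \<noteq> 0"
    "\<And>t. poly (hahn_poly n s s s) (of_nat s - t) = poly (newton_sum a s) t"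
    using newton_expansion_reflected
      [OF degree_hahn_poly[OF order_refl le order_refl] hahn_poly_neq_0, of "of_nat s"]
    by metis
  have "(\<Sum>y\<in>Xr n s. \<phi> y * hahn_kernel n s s y x) = a s * \<phi> x" if \<phi>: "\<phi> \<in> Specht n s" for \<phi> x
  proof (cases "x \<in> Xr n s")
    case True
    have "hahn_kernel n s s y x = poly (newton_sum a s) (of_nat (card (x \<inter> y)))"
      if "y \<in> Xr n s" for y
    proof -
      have "of_nat (card (y - x)) = (of_nat s - of_nat (card (x \<inter> y)) :: complex)"
        by (simp add: Int_commute flip: card_Diff_plus_card_Int[OF that, of x])
      thus ?thesis using True by (simp add: hahn_kernel_def flip: a(2))
    qed
    hence "(\<Sum>y\<in>Xr n s. \<phi> y * hahn_kernel n s s y x)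
      = (\<Sum>y\<in>Xr n s. (\<lambda>i. poly (newton_sum a s) (of_nat i)) (card (x \<inter> y)) * \<phi> y)"
      by (intro sum.cong refl) simp
    also have "\<dots> = a s * (\<Sum>y\<in>{y \<in> Xr n s. y \<subseteq> x}. \<phi> y)"
      by (rule Specht_kernel[OF \<phi>]) (use True in \<open>auto simp: poly_newton_sum_of_nat Xr_def\<close>)
    also have "{y \<in> Xr n s. y \<subseteq> x} = {x}"
      using card_subset_eq[OF finite_of_Xr[OF True]] True by (auto simp: Xr_def)
    finally show ?thesis by simp
  next
    case False
    thus ?thesis using Specht_eq_0_outside[OF \<phi>] by (simp add: hahn_kernel_def)
  qed
  thus ?thesis using that a(1) by blast
qed

section \<open>Equivariant maps out of the Specht module\<close>

lemma permutes_image_in_Xr: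
  assumes "g permutes {0..<n}"
  shows "g ` x \<in> Xr n r \<longleftrightarrow> x \<in> Xr n r"
proof -
  have "g ` x \<subseteq> {0..<n} \<longleftrightarrow> x \<subseteq> {0..<n}"
    using inj_image_subset_iff[OF permutes_inj[OF assms], of x "{0..<n}"]
    by (simp add: permutes_image[OF assms])
  thus ?thesis
    by (simp add: Xr_def card_image[OF permutes_inj_on[OF assms]])
qed

lemma permutes_image_inv:
  assumes "g permutes S"
  shows "g ` (inv g ` x) = x" "inv g ` (g ` x) = x"
  by (rule image_f_inv_f[OF permutes_surj[OF assms]], rule image_inv_f_f[OF permutes_inj[OF assms]])

lemma permutes_inv_image_subset_iff:
  assumes "g permutes S"
  shows "x \<subseteq> inv g ` y \<longleftrightarrow> g ` x \<subseteq> y" "inv g ` x \<subseteq> y \<longleftrightarrow> x \<subseteq> g ` y"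
  by (metis image_mono permutes_image_inv[OF assms])+

lemma sum_Xr_permute:
  fixes F :: "nat set \<Rightarrow> complex"
  assumes "g permutes {0..<n}"
  shows "(\<Sum>x\<in>{x \<in> Xr n r. P x}. F (inv g ` x)) = (\<Sum>x\<in>{x \<in> Xr n r. P (g ` x)}. F x)"
  by (rule sum.reindex_bij_witness[where i = "image g" and j = "image (inv g)"])
    (auto simp: permutes_image_inv[OF assms] permutes_image_in_Xr[OF assms]
      permutes_image_in_Xr[OF permutes_inv[OF assms]])

lemma rho_in_Specht:
  assumes g: "g permutes {0..<n}" and \<phi>: "\<phi> \<in> Specht n s"
  shows "rho g \<phi> \<in> Specht n s"
proof -
  have "(\<Sum>x\<in>{x \<in> Xr n s. y \<subseteq> x}. rho g \<phi> x) = 0" if "s \<ge> 1" "y \<in> Xr n (s - 1)" for y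
  proof -
    have "(\<Sum>x\<in>{x \<in> Xr n s. y \<subseteq> x}. rho g \<phi> x) = (\<Sum>x\<in>{x \<in> Xr n s. inv g ` y \<subseteq> x}. \<phi> x)"
      unfolding rho_def sum_Xr_permute[OF g] permutes_inv_image_subset_iff[OF g] ..
    moreover have "inv g ` y \<in> Xr n (s - 1)"
      using that permutes_image_in_Xr[OF permutes_inv[OF g]] by simp
    ultimately show ?thesis using \<phi> that by (simp add: Specht_def)
  qed
  thus ?thesis
    using \<phi> permutes_image_in_Xr[OF permutes_inv[OF g]] by (auto simp: Specht_def L2Xr_def rho_def)
qed

lemma up_map_rho:
  assumes g: "g permutes {0..<n}"
  shows "up_map n s r (rho g \<phi>) = rho g (up_map n s r \<phi>)"
proof
  fix x
  show "up_map n s r (rho g \<phi>) x = rho g (up_map n s r \<phi>) x"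
    by (simp add: rho_def up_map_def sum_Xr_permute[OF g, where P = "\<lambda>y. y \<subseteq> x" and F = \<phi>]
      permutes_image_in_Xr[OF permutes_inv[OF g]] permutes_inv_image_subset_iff[OF g])
qed

lemma kerop_rho:
  assumes g: "g permutes {0..<n}"
  shows "kerop n r1 r2 lam (rho g \<psi>) = rho g (kerop n r1 r2 lam \<psi>)"
proof
  fix x2
  have "card (x2 - x1) = card (inv g ` x2 - inv g ` x1)" for x1
    using permutes_inj[OF permutes_inv[OF g]] permutes_inj_on[OF permutes_inv[OF g]]
    by (simp add: image_set_diff[symmetric] card_image)
  hence "(\<Sum>x1\<in>Xr n r1. lam (card (x2 - x1)) * \<psi> (inv g ` x1))
      = (\<Sum>x1\<in>{x1 \<in> Xr n r1. True}. (\<lambda>x. lam (card (inv g ` x2 - x)) * \<psi> x) (inv g ` x1))"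
    by simp
  also have "\<dots> = (\<Sum>x1\<in>Xr n r1. lam (card (inv g ` x2 - x1)) * \<psi> x1)"
    by (subst sum_Xr_permute[OF g]) simp
  finally show "kerop n r1 r2 lam (rho g \<psi>) x2 = rho g (kerop n r1 r2 lam \<psi>) x2"
    by (simp add: kerop_def rho_def permutes_image_in_Xr[OF permutes_inv[OF g]])
qed

lemma rho_hahn_kernel:
  assumes g: "g permutes {0..<n}"
  shows "rho g (hahn_kernel n r s y) = hahn_kernel n r s (g ` y)"
proof -
  have "card (y - inv g ` x) = card (g ` y - x)" for x
  proof -
    have "g ` (y - inv g ` x) = g ` y - x"
      using permutes_inj[OF g] by (simp add: image_set_diff permutes_image_inv[OF g])
    thus ?thesis by (metis card_image permutes_inj_on[OF g])
  qed
  thus ?thesis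
    by (intro ext) (simp add: rho_def hahn_kernel_def permutes_image_in_Xr[OF permutes_inv[OF g]])
qed

text \<open>Each point is labelled by its membership in \<open>x\<close> and in \<open>y\<close>.
  The sizes of \<open>x\<close>, \<open>y\<close> and their intersection fix the sizes of all four
  label classes, so some permutation matches the labels of the two pairs.\<close>

lemma permutes_pair_transitive:
  assumes "x \<in> Xr n r" "x' \<in> Xr n r" "y \<in> Xr n s" "y' \<in> Xr n s" "card (x \<inter> y) = card (x' \<inter> y')"
  obtains g where "g permutes {0..<n}" "g ` x = x'" "g ` y = y'"
proof -
  let ?A = "{0..<n}"
  let ?f = "\<lambda>x y a. (a \<in> x, a \<in> y)"
  have sub: "x \<subseteq> ?A" "x' \<subseteq> ?A" "y \<subseteq> ?A" "y' \<subseteq> ?A" using assms by (auto simp: Xr_def)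
  have fin: "finite x" "finite x'" "finite y" "finite y'" using assms finite_of_Xr by blast+
  have cd: "card (x - y) = card (x' - y')" "card (y - x) = card (y' - x')"
    using card_Diff_plus_card_Int[OF assms(1), of y] card_Diff_plus_card_Int[OF assms(2), of y']
      card_Diff_plus_card_Int[OF assms(3), of x] card_Diff_plus_card_Int[OF assms(4), of x'] assms(5)
    by (simp_all add: Int_commute)
  have un: "card (x \<union> y) = card (x' \<union> y')"
    using card_Un_Int[OF fin(1,3)] card_Un_Int[OF fin(2,4)] assms by (simp add: Xr_def)
  have "card {a \<in> ?A. ?f x y a = l} = card {a \<in> ?A. ?f x' y' a = l}" for l
  proof -
    have eqs: "{a \<in> ?A. ?f u v a = (True, True)} = u \<inter> v" "{a \<in> ?A. ?f u v a = (True, False)} = u - v"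
      "{a \<in> ?A. ?f u v a = (False, True)} = v - u" "{a \<in> ?A. ?f u v a = (False, False)} = ?A - (u \<union> v)"
      if "u \<subseteq> ?A" "v \<subseteq> ?A" for u v
      using that by auto
    have "card (?A - (x \<union> y)) = card (?A - (x' \<union> y'))"
      using sub fin un by (simp add: card_Diff_subset)
    moreover have "l \<in> {(True, True), (True, False), (False, True), (False, False)}"
      by (cases l) auto
    ultimately show ?thesis
      using eqs[OF sub(1,3)] eqs[OF sub(2,4)] cd assms(5) by (elim insertE emptyE) simp_all
  qed
  hence "image_mset (?f x y) (mset_set ?A) = image_mset (?f x' y') (mset_set ?A)"
    by (intro multiset_eqI) (simp add: count_image_mset_eq_card_vimage)
  then obtain g where g: "g permutes ?A" and gf: "\<forall>a\<in>?A. ?f x y a = ?f x' y' (g a)"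
    using image_mset_eq_implies_permutes[of ?A "?f x y" "?f x' y'"] by blast
  have "g ` u = u'" if u: "u \<subseteq> ?A" "u' \<subseteq> ?A" "\<forall>a\<in>?A. a \<in> u \<longleftrightarrow> g a \<in> u'" for u u'
  proof
    show "g ` u \<subseteq> u'" using u by auto
    show "u' \<subseteq> g ` u"
    proof
      fix b assume b: "b \<in> u'"
      then obtain a where "a \<in> ?A" "b = g a" using u(2) permutes_image[OF g] by blast
      thus "b \<in> g ` u" using b u(3) by auto
    qed
  qed
  thus ?thesis using that[OF g] sub gf by simp
qed

section \<open>Linearity and Schur's lemma for the Specht module\<close>

lemma csubspace_Specht: "csubspace (Specht n s)"
proof -
  have "L2Xr n s = {\<psi>. \<forall>x. x \<notin> Xr n s \<longrightarrow> \<psi> x = 0}" by (auto simp: L2Xr_def)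
  thus ?thesis
    by (simp add: csubspace_def Specht_def sum.distrib flip: sum_distrib_left)
qed

lemma csubspace_sum:
  assumes "csubspace V" "finite I" "\<And>i. i \<in> I \<Longrightarrow> v i \<in> V"
  shows "(\<lambda>x. \<Sum>i\<in>I. c i * v i x) \<in> V"
  using assms(2,3)
proof (induction I rule: finite_induct)
  case (insert i I)
  thus ?case using assms(1) by (simp add: csubspace_def)
qed (use assms(1) in \<open>simp add: csubspace_def\<close>)

lemma linear_map_sum:
  assumes V: "csubspace V" and "finite I" "\<And>i. i \<in> I \<Longrightarrow> v i \<in> V"
    and add: "\<forall>\<phi>\<in>V. \<forall>\<psi>\<in>V. T (\<lambda>x. \<phi> x + \<psi> x) = (\<lambda>x. T \<phi> x + T \<psi> x)"
    and scale: "\<forall>c. \<forall>\<phi>\<in>V. T (\<lambda>x. c * \<phi> x) = (\<lambda>x. c * T \<phi> x)"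
  shows "T (\<lambda>x. \<Sum>i\<in>I. c i * v i x) = (\<lambda>x. \<Sum>i\<in>I. c i * T (v i) x)"
  using assms(2,3)
proof (induction I rule: finite_induct)
  case empty
  have "(\<lambda>_. 0) \<in> V" using V by (simp add: csubspace_def)
  from scale[rule_format, OF this, of 0] show ?case by simp
next
  case (insert i I)
  have 1: "(\<lambda>x. c i * v i x) \<in> V" using V insert by (simp add: csubspace_def)
  have 2: "(\<lambda>x. \<Sum>i\<in>I. c i * v i x) \<in> V" using V insert by (intro csubspace_sum) auto
  show ?case using add[rule_format, OF 1 2] insert scale by simp
qed

text \<open>An equivariant map has a kernel depending only on \<open>|x \<inter> y|\<close>, because it is determined by its
  values on the functions \<open>hahn_kernel n s s y\<close>, which span the Specht module by the reproducing
  property. On the Specht module such a kernel is a multiple of the inclusion kernel.\<close>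

lemma Specht_equivariant_scalar:
  assumes "2 * s \<le> n"
    and into: "\<And>\<phi>. \<phi> \<in> Specht n s \<Longrightarrow> T \<phi> \<in> L2Xr n r"
    and add: "\<forall>\<phi>\<in>Specht n s. \<forall>\<psi>\<in>Specht n s. T (\<lambda>x. \<phi> x + \<psi> x) = (\<lambda>x. T \<phi> x + T \<psi> x)"
    and scale: "\<forall>c. \<forall>\<phi>\<in>Specht n s. T (\<lambda>x. c * \<phi> x) = (\<lambda>x. c * T \<phi> x)"
    and equiv: "\<forall>g\<in>Sym n. \<forall>\<phi>\<in>Specht n s. T (rho g \<phi>) = rho g (T \<phi>)"
  obtains c where "\<And>\<phi>. \<phi> \<in> Specht n s \<Longrightarrow> T \<phi> = (\<lambda>x. c * up_map n s r \<phi> x)"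
proof -
  let ?\<kappa> = "hahn_kernel n s s"
  have \<kappa>: "?\<kappa> y \<in> Specht n s" if "y \<in> Xr n s" for y
    using hahn_kernel_in_Specht[OF assms(1) order_refl that] .
  obtain a where a: "a \<noteq> 0"
    "\<And>\<phi> x. \<phi> \<in> Specht n s \<Longrightarrow> (\<Sum>y\<in>Xr n s. \<phi> y * ?\<kappa> y x) = a * \<phi> x"
    using hahn_kernel_reproducing[OF assms(1)] by blast
  \<comment> \<open>A permutation moving \<open>(x, y)\<close> to \<open>(x', y')\<close> carries
    one kernel to the other, and \<open>T\<close> commutes with it.\<close>
  have inv: "T (?\<kappa> y) x = T (?\<kappa> y') x'"
    if xy: "x \<in> Xr n r" "x' \<in> Xr n r" "y \<in> Xr n s" "y' \<in> Xr n s" "card (x \<inter> y) = card (x' \<inter> y')"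
    for x x' y y'
  proof -
    obtain g where g: "g permutes {0..<n}" "g ` x = x'" "g ` y = y'"
      using permutes_pair_transitive[OF xy] .
    have "T (?\<kappa> y') = rho g (T (?\<kappa> y))"
      using equiv \<kappa>[OF xy(3)] g rho_hahn_kernel[OF g(1), of s s y]
      by (metis Sym_def mem_Collect_eq)
    thus ?thesis using permutes_image_inv(2)[OF g(1), of x] g(2) by (simp add: rho_def)
  qed
  \<comment> \<open>By \<open>inv\<close> the choice is forced at every attained intersection size;
    elsewhere the value is arbitrary and never evaluated against \<open>T\<close>.\<close>
  define f where "f i = (SOME v. \<exists>x\<in>Xr n r. \<exists>y\<in>Xr n s. card (x \<inter> y) = i \<and> v = T (?\<kappa> y) x)" for i
  have f: "T (?\<kappa> y) x = f (card (x \<inter> y))" if "x \<in> Xr n r" "y \<in> Xr n s" for x y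
  proof -
    have "\<exists>x'\<in>Xr n r. \<exists>y'\<in>Xr n s. card (x' \<inter> y') = card (x \<inter> y) \<and> f (card (x \<inter> y)) = T (?\<kappa> y') x'"
      unfolding f_def by (rule someI) (use that in blast)
    thus ?thesis using inv that by metis
  qed
  obtain b where b: "\<forall>i\<le>s. f i = (\<Sum>j\<le>s. b j * of_nat (i choose j))"
    using newton_interpolation by blast
  have "T \<phi> = (\<lambda>x. b s / a * up_map n s r \<phi> x)" if \<phi>: "\<phi> \<in> Specht n s" for \<phi>
  proof
    fix x
    show "T \<phi> x = b s / a * up_map n s r \<phi> x"
    proof (cases "x \<in> Xr n r")
      case True
      \<comment> \<open>The reproducing property expands \<open>\<phi>\<close> in the kernels, so
        linearity turns \<open>T\<close> into a sum with kernel
        \<open>f (card (x \<inter> y))\<close>.\<close>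
      have "(\<lambda>x. a * \<phi> x) = (\<lambda>x. \<Sum>y\<in>Xr n s. \<phi> y * ?\<kappa> y x)" using a \<phi> by simp
      hence "a * T \<phi> x = T (\<lambda>x. \<Sum>y\<in>Xr n s. \<phi> y * ?\<kappa> y x) x"
        using scale \<phi> by (metis (no_types, lifting))
      also have "\<dots> = (\<Sum>y\<in>Xr n s. \<phi> y * T (?\<kappa> y) x)"
        by (subst linear_map_sum[OF csubspace_Specht _ \<kappa> add scale]) auto
      also have "\<dots> = (\<Sum>y\<in>Xr n s. f (card (x \<inter> y)) * \<phi> y)"
        using True by (intro sum.cong refl) (simp add: f)
      also have "\<dots> = b s * (\<Sum>y\<in>{y \<in> Xr n s. y \<subseteq> x}. \<phi> y)"
        by (rule Specht_kernel[OF \<phi>]) (use b True in \<open>auto simp: Xr_def\<close>)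
      finally show ?thesis using a(1) True by (simp add: up_map_def field_simps)
    next
      case False
      thus ?thesis using into[OF \<phi>] by (auto simp: L2Xr_def up_map_def)
    qed
  qed
  thus ?thesis using that by blast
qed

section \<open>The component of type \<open>s\<close> as the image of \<open>up_map\<close>\<close>

lemma up_map_in_L2Xr: "up_map n s r \<phi> \<in> L2Xr n r"
  by (simp add: L2Xr_def up_map_def)

lemma up_map_add: "up_map n s r (\<lambda>x. \<phi> x + \<psi> x) = (\<lambda>x. up_map n s r \<phi> x + up_map n s r \<psi> x)"
  by (auto simp: up_map_def sum.distrib)

lemma up_map_scale: "up_map n s r (\<lambda>x. c * \<phi> x) = (\<lambda>x. c * up_map n s r \<phi> x)"
  by (auto simp: up_map_def sum_distrib_left)

lemma is_comp_up_map:
  assumes "s \<le> r" "s \<le> n - r" "r \<le> n"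
  shows "is_comp n r s (up_map n s r ` Specht n s)"
  unfolding is_comp_def
proof (intro conjI)
  have S: "(\<lambda>_. 0) \<in> Specht n s" "\<And>\<phi> \<psi>. \<phi> \<in> Specht n s \<Longrightarrow> \<psi> \<in> Specht n s \<Longrightarrow> (\<lambda>x. \<phi> x + \<psi> x) \<in> Specht n s"
    "\<And>c \<phi>. \<phi> \<in> Specht n s \<Longrightarrow> (\<lambda>x. c * \<phi> x) \<in> Specht n s"
    using csubspace_Specht[of n s] by (auto simp: csubspace_def)
  show "csubspace (up_map n s r ` Specht n s)"
    unfolding csubspace_def
  proof (intro conjI ballI allI)
    have "(\<lambda>_. 0) = up_map n s r (\<lambda>_. 0)" by (auto simp: up_map_def)
    thus "(\<lambda>_. 0) \<in> up_map n s r ` Specht n s" using S(1) by blast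
  qed (use S in \<open>auto simp flip: up_map_add up_map_scale\<close>)
  show "G_invariant n (up_map n s r ` Specht n s)"
    by (auto simp: G_invariant_def Sym_def rho_in_Specht simp flip: up_map_rho)
  show "G_iso n (Specht n s) (up_map n s r ` Specht n s)"
    unfolding G_iso_def
    by (rule exI[of _ "up_map n s r"])
      (auto simp: Sym_def up_map_add up_map_scale up_map_rho intro: inj_on_imp_bij_betw inj_on_up_map[OF assms])
qed (auto simp: up_map_in_L2Xr)

lemma ex_in_Xr: "r \<le> n \<Longrightarrow> {0..<r} \<in> Xr n r"
  by (auto simp: Xr_def)

text \<open>An isomorphism from the Specht module onto any candidate \<open>W\<close> is
  \<open>c\<close> times \<open>up_map\<close> by Schur's lemma. Since \<open>c\<close> is nonzero,
  both maps have the same image.\<close>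

lemma comp_eq_up_map_image:
  assumes "s \<le> r" "s \<le> n - r" "r \<le> n"
  shows "comp n r s = up_map n s r ` Specht n s"
  unfolding comp_def
proof (rule the_equality)
  show "is_comp n r s (up_map n s r ` Specht n s)" by (rule is_comp_up_map[OF assms])
next
  fix W assume W: "is_comp n r s W"
  have s2: "2 * s \<le> n" using assms by simp
  obtain T where T: "bij_betw T (Specht n s) W"
    "\<forall>\<phi>\<in>Specht n s. \<forall>\<psi>\<in>Specht n s. T (\<lambda>x. \<phi> x + \<psi> x) = (\<lambda>x. T \<phi> x + T \<psi> x)"
    "\<forall>c. \<forall>\<phi>\<in>Specht n s. T (\<lambda>x. c * \<phi> x) = (\<lambda>x. c * T \<phi> x)"
    "\<forall>g\<in>Sym n. \<forall>\<phi>\<in>Specht n s. T (rho g \<phi>) = rho g (T \<phi>)"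
    using W unfolding is_comp_def G_iso_def by blast
  have into: "T \<phi> \<in> L2Xr n r" if "\<phi> \<in> Specht n s" for \<phi>
    using bij_betwE[OF T(1)] that W by (auto simp: is_comp_def)
  obtain c where c: "\<And>\<phi>. \<phi> \<in> Specht n s \<Longrightarrow> T \<phi> = (\<lambda>x. c * up_map n s r \<phi> x)"
    using Specht_equivariant_scalar[OF s2 into T(2-4)] by blast
  have scaled: "(\<lambda>x. d * \<phi> x) \<in> Specht n s" if "\<phi> \<in> Specht n s" for d \<phi>
    using csubspace_Specht that by (simp add: csubspace_def)
  have "c \<noteq> 0"
  proof
    assume "c = 0"
    have y: "{0..<s} \<in> Xr n s" using s2 by (intro ex_in_Xr) simp
    \<comment> \<open>A nonzero element, with value \<open>1\<close> at \<open>{0..<s}\<close>;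
      \<open>c = 0\<close> would send it and zero to the same function.\<close>
    let ?\<kappa> = "hahn_kernel n s s {0..<s}"
    have \<kappa>: "?\<kappa> \<in> Specht n s" by (rule hahn_kernel_in_Specht[OF s2 order_refl y])
    have z: "(\<lambda>x. 0 * ?\<kappa> x) \<in> Specht n s" by (rule scaled[OF \<kappa>])
    have "T ?\<kappa> = T (\<lambda>x. 0 * ?\<kappa> x)" using c[OF \<kappa>] c[OF z] \<open>c = 0\<close> by simp
    hence "?\<kappa> = (\<lambda>x. 0 * ?\<kappa> x)" using T(1) \<kappa> z unfolding bij_betw_def inj_on_def by blast
    hence "?\<kappa> {0..<s} = 0" by (metis mult_zero_left)
    thus False using y by (simp add: hahn_kernel_def)
  qed
  have "W = T ` Specht n s" using T(1) by (simp add: bij_betw_def)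
  also have "\<dots> = up_map n s r ` Specht n s"
  proof (intro equalityI subsetI)
    fix \<psi> assume "\<psi> \<in> T ` Specht n s"
    then obtain \<phi> where \<phi>: "\<phi> \<in> Specht n s" "\<psi> = T \<phi>" by blast
    hence "\<psi> = up_map n s r (\<lambda>x. c * \<phi> x)" by (simp add: c up_map_scale)
    thus "\<psi> \<in> up_map n s r ` Specht n s" using scaled[OF \<phi>(1)] by blast
  next
    fix \<psi> assume "\<psi> \<in> up_map n s r ` Specht n s"
    then obtain \<phi> where \<phi>: "\<phi> \<in> Specht n s" "\<psi> = up_map n s r \<phi>" by blast
    have "T (\<lambda>x. inverse c * \<phi> x) = \<psi>"
      using c[OF scaled[OF \<phi>(1), of "inverse c"]] \<open>c \<noteq> 0\<close> \<phi>(2)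
      by (simp add: up_map_scale flip: mult.assoc)
    thus "\<psi> \<in> T ` Specht n s" using scaled[OF \<phi>(1)] by blast
  qed
  finally show "W = up_map n s r ` Specht n s" .
qed

section \<open>The polynomial of the intertwining operator\<close>

text \<open>The rows of the kernel lie in the component. The image of
  \<open>hahn_kernel n r2 s x\<close> is a polynomial \<open>P\<close> in
  \<open>card (x - x1)\<close> with vanishing superset sums, hence proportional to
  \<open>hahn_poly\<close>; dividing by \<open>poly P 0\<close> gives the row.\<close>

lemma hahn_poly_as_up_map:
  assumes "s \<le> r1" "s \<le> n - r1" "r1 \<le> n" "s \<le> r2" "s \<le> n - r2" "r2 \<le> n" and x2: "x2 \<in> Xr n r2"
  obtains \<phi> where "\<phi> \<in> Specht n s"
    "\<And>x1. x1 \<in> Xr n r1 \<Longrightarrow> up_map n s r1 \<phi> x1 = poly (hahn_poly n r1 r2 s) (of_nat (card (x2 - x1)))"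
proof -
  have s2: "2 * s \<le> n" "s \<le> n - s" "s \<le> n" using assms by simp_all
  obtain b where b: "b s \<noteq> 0"
    "\<And>t. poly (hahn_poly n s r2 s) (of_nat r2 - t) = poly (newton_sum b s) t"
    using newton_expansion_reflected
      [OF degree_hahn_poly[OF order_refl s2(2,3) assms(4)] hahn_poly_neq_0, of "of_nat r2"]
    by metis
  \<comment> \<open>The weight is the number of \<open>s\<close>-sets between an
    \<open>i\<close>-set and an \<open>r1\<close>-set; \<open>q\<close> is in the variable
    \<open>card (x \<inter> x1)\<close>, and \<open>P\<close> reflects it back to
    differences.\<close>
  define q where "q = newton_sum (\<lambda>i. b i * of_nat ((r1 - i) choose (s - i))) s"
  define P where "P = pcompose q [:of_nat r2, -1:]"
  have card: "of_nat (card (x - y)) = (of_nat r2 - of_nat (card (x \<inter> y)) :: complex)"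
    if "x \<in> Xr n r2" for x y
    by (simp flip: card_Diff_plus_card_Int[OF that, of y])
  \<comment> \<open>This is needed for every \<open>x\<close>, not just \<open>x2\<close>, since the
    uniqueness lemma uses superset sums for all sets in \<open>Xr n r2\<close>.\<close>
  have up: "up_map n s r1 (hahn_kernel n r2 s x) x1 = poly P (of_nat (card (x - x1)))"
    if x: "x \<in> Xr n r2" and x1: "x1 \<in> Xr n r1" for x x1
  proof -
    let ?Y = "{y \<in> Xr n s. y \<subseteq> x1}"
    have fx: "finite x" by (rule finite_of_Xr[OF x])
    have inner: "(\<Sum>y\<in>?Y. of_nat (card (x \<inter> y) choose i) :: complex)
        = of_nat ((r1 - i) choose (s - i)) * of_nat (card (x \<inter> x1) choose i)" if "i \<le> s" for i
    proof -
      have cnt: "card {y \<in> ?Y. w \<subseteq> y} = (if w \<subseteq> x \<inter> x1 then (r1 - i) choose (s - i) else 0)"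
        if w: "w \<subseteq> x" "card w = i" for w
      proof (cases "w \<subseteq> x1")
        case True
        have "{y \<in> ?Y. w \<subseteq> y} = {y \<in> Xr n s. w \<subseteq> y \<and> y \<inter> ({0..<n} - x1) = {}}"
          using x1 by (auto simp: Xr_def)
        moreover have "card {y \<in> Xr n s. w \<subseteq> y \<and> y \<inter> ({0..<n} - x1) = {}}
            = (r1 - i) choose (s - i)"
        proof -
          have "card ({0..<n} - x1) = n - r1"
            using x1 by (auto simp: Xr_def card_Diff_subset finite_subset)
          moreover have "w \<subseteq> {0..<n}" "w \<inter> ({0..<n} - x1) = {}"
            using True x1 by (auto simp: Xr_def)
          moreover have "n - i - (n - r1) = r1 - i" using assms(3) by simp
          ultimately show ?thesis
            using card_Xr_between[of w n "{0..<n} - x1" s] w(2) \<open>i \<le> s\<close> by simp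
        qed
        ultimately show ?thesis using True w by simp
      next
        case False
        hence "{y \<in> ?Y. w \<subseteq> y} = {}" by blast
        thus ?thesis using False by simp
      qed
      have "(\<Sum>y\<in>?Y. of_nat (card (x \<inter> y) choose i) :: complex)
          = (\<Sum>w | w \<subseteq> x \<and> card w = i. \<Sum>y\<in>{y \<in> ?Y. w \<subseteq> y}. 1)"
        using sum_binomial_card_Int[OF fx, of ?Y i "\<lambda>_. 1"] by simp
      also have "\<dots> = (\<Sum>w | w \<subseteq> x \<and> card w = i.
          if w \<subseteq> x \<inter> x1 then of_nat ((r1 - i) choose (s - i)) else 0)"
      proof (rule sum.cong[OF refl])
        fix w assume "w \<in> {w. w \<subseteq> x \<and> card w = i}"
        hence "card {y \<in> ?Y. w \<subseteq> y} = (if w \<subseteq> x \<inter> x1 then (r1 - i) choose (s - i) else 0)"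
          by (intro cnt) auto
        thus "(\<Sum>y\<in>{y \<in> ?Y. w \<subseteq> y}. 1)
            = (if w \<subseteq> x \<inter> x1 then of_nat ((r1 - i) choose (s - i)) else 0 :: complex)"
          by (simp only: sum_constant mult_1_right) simp
      qed
      also have "\<dots> = (\<Sum>w\<in>{w. w \<subseteq> x \<inter> x1 \<and> card w = i}. of_nat ((r1 - i) choose (s - i)))"
      proof -
        have "{w \<in> {w. w \<subseteq> x \<and> card w = i}. w \<subseteq> x \<inter> x1} = {w. w \<subseteq> x \<inter> x1 \<and> card w = i}"
          by auto
        moreover have "finite {w. w \<subseteq> x \<and> card w = i}" using fx by simp
        ultimately show ?thesis by (simp only: sum.inter_filter[symmetric])
      qed
      also have "\<dots> = of_nat ((r1 - i) choose (s - i)) * of_nat (card (x \<inter> x1) choose i)"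
        using fx n_subsets[of "x \<inter> x1" i] by (simp del: Int_subset_iff le_inf_iff)
      finally show ?thesis .
    qed
    have "up_map n s r1 (hahn_kernel n r2 s x) x1
        = (\<Sum>y\<in>?Y. poly (newton_sum b s) (of_nat (card (x \<inter> y))))"
      using x1 by (simp add: up_map_def hahn_kernel_def card[OF x] flip: b(2))
    also have "\<dots> = (\<Sum>i\<le>s. b i * (\<Sum>y\<in>?Y. of_nat (card (x \<inter> y) choose i)))"
      unfolding poly_newton_sum_of_nat by (subst sum.swap) (simp add: sum_distrib_left)
    also have "\<dots> = poly q (of_nat (card (x \<inter> x1)))"
      unfolding q_def poly_newton_sum_of_nat
      by (intro sum.cong refl) (simp add: inner mult.assoc)
    also have "\<dots> = poly P (of_nat (card (x - x1)))"
      by (simp add: P_def poly_pcompose card[OF x])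
    finally show ?thesis .
  qed
  have degP: "degree P \<le> s"
    using degree_newton_sum by (simp add: P_def q_def degree_pcompose)
  have P_sums: "(\<Sum>x1\<in>{x1 \<in> Xr n r1. z \<subseteq> x1}. poly P (of_nat (card (x - x1)))) = 0"
    if "s \<ge> 1" "z \<in> Xr n (s - 1)" "x \<in> Xr n r2" for x z
    using up_map_sum_supersets_eq_0[OF hahn_kernel_in_Specht[OF s2(1) assms(4) that(3)] that(1,2), of r1]
    by (simp add: up that(3))
  have "P - smult (poly P 0) (hahn_poly n r1 r2 s) = 0"
  proof (rule poly_eq_0_of_sum_supersets[OF _ _ assms(1-6)])
    show "degree (P - smult (poly P 0) (hahn_poly n r1 r2 s)) \<le> s"
      by (intro degree_diff_le degP order_trans[OF degree_smult_le])
        (simp add: degree_hahn_poly[OF assms(1-4)])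
    show "(\<Sum>x1\<in>{x1 \<in> Xr n r1. z \<subseteq> x1}.
        poly (P - smult (poly P 0) (hahn_poly n r1 r2 s)) (of_nat (card (x - x1)))) = 0"
      if "s \<ge> 1" "z \<in> Xr n (s - 1)" "x \<in> Xr n r2" for x z
      using P_sums[OF that] hahn_poly_sum_supersets_eq_0[OF that(1) assms(1-4) that(2,3)]
      by (simp add: sum_subtractf flip: sum_distrib_left)
  qed simp
  hence P: "P = smult (poly P 0) (hahn_poly n r1 r2 s)" by simp
  \<comment> \<open>If \<open>poly P 0\<close> vanished, so would \<open>P\<close> and
    \<open>q\<close>, and with \<open>q\<close> the top coefficient \<open>b s\<close>.\<close>
  have P0: "poly P 0 \<noteq> 0"
  proof
    assume "poly P 0 = 0"
    with P have "P = 0" by simp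
    hence "q = 0" unfolding P_def using pcompose_eq_0[of q "[:of_nat r2, -1:]"] by simp
    hence "b s * of_nat ((r1 - s) choose (s - s)) = 0"
      unfolding q_def using newton_sum_eq_0D[OF _ order_refl] by blast
    thus False using b(1) by simp
  qed
  show ?thesis
  proof (rule that)
    show "(\<lambda>y. inverse (poly P 0) * hahn_kernel n r2 s x2 y) \<in> Specht n s"
      using csubspace_Specht hahn_kernel_in_Specht[OF s2(1) assms(4) x2] by (simp add: csubspace_def)
    fix x1 assume "x1 \<in> Xr n r1"
    thus "up_map n s r1 (\<lambda>y. inverse (poly P 0) * hahn_kernel n r2 s x2 y) x1
        = poly (hahn_poly n r1 r2 s) (of_nat (card (x2 - x1)))"
      using P0 by (subst up_map_scale) (simp add: up x2, subst P, simp)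
  qed
qed

lemma cnj_in_Specht: "\<phi> \<in> Specht n s \<Longrightarrow> (\<lambda>x. cnj (\<phi> x)) \<in> Specht n s"
  by (auto simp: Specht_def L2Xr_def simp flip: cnj_sum)

lemma up_map_cnj: "up_map n s r (\<lambda>x. cnj (\<phi> x)) = (\<lambda>x. cnj (up_map n s r \<phi> x))"
  by (auto simp: up_map_def)

lemma inner_eq_sum_Xr:
  assumes "\<phi> \<in> L2Xr n r"
  shows "inner n \<psi> \<phi> = (\<Sum>x\<in>Xr n r. \<psi> x * cnj (\<phi> x))"
  unfolding inner_def
  by (rule sum.mono_neutral_right) (use assms in \<open>auto simp: Xr_def L2Xr_def\<close>)

text \<open>These bounds are the domain of the kernel, so \<open>kerop\<close> only sees values of
  \<open>lam\<close> at which it agrees with the polynomial.\<close>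

lemma card_Diff_range:
  assumes "x1 \<in> Xr n r1" "x2 \<in> Xr n r2"
  shows "r2 - r1 \<le> card (x2 - x1)" "card (x2 - x1) \<le> min (n - r1) r2"
proof -
  have fin: "finite x1" "finite x2" using assms finite_of_Xr by blast+
  show "r2 - r1 \<le> card (x2 - x1)"
    using diff_card_le_card_Diff[OF fin(1), of x2] assms by (simp add: Xr_def)
  have "card (x2 - x1) \<le> card ({0..<n} - x1)"
    using assms by (intro card_mono) (auto simp: Xr_def)
  moreover have "card ({0..<n} - x1) = n - r1"
    using assms fin by (simp add: Xr_def card_Diff_subset)
  moreover have "card (x2 - x1) \<le> r2"
    using card_mono[OF fin(2), of "x2 - x1"] assms by (auto simp: Xr_def)
  ultimately show "card (x2 - x1) \<le> min (n - r1) r2" by simp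
qed

lemma kerop_poly_cong:
  assumes "\<forall>k. r2 - r1 \<le> k \<and> k \<le> min (n - r1) r2 \<longrightarrow> lam k = poly p (of_nat k)"
  shows "kerop n r1 r2 lam \<psi> = kerop n r1 r2 (\<lambda>k. poly p (of_nat k)) \<psi>"
  unfolding kerop_def using assms card_Diff_range by (intro ext if_cong refl sum.cong) metis

lemma kerop_add: "kerop n r1 r2 lam (\<lambda>x. \<phi> x + \<psi> x)
    = (\<lambda>x. kerop n r1 r2 lam \<phi> x + kerop n r1 r2 lam \<psi> x)"
  by (auto simp: kerop_def distrib_left sum.distrib)

lemma kerop_scale: "kerop n r1 r2 lam (\<lambda>x. c * \<phi> x) = (\<lambda>x. c * kerop n r1 r2 lam \<phi> x)"
  by (auto simp: kerop_def sum_distrib_left mult_ac)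

text \<open>For any \<open>lam\<close>, composing \<open>kerop\<close> with \<open>up_map\<close>
  gives an equivariant map on the Specht module, hence a multiple of \<open>up_map\<close> into
  level \<open>r2\<close>.\<close>

lemma kerop_comp:
  assumes "s \<le> r1" "s \<le> n - r1" "r1 \<le> n" "s \<le> r2" "s \<le> n - r2" "r2 \<le> n"
    and \<psi>: "\<psi> \<in> comp n r1 s"
  shows "kerop n r1 r2 lam \<psi> \<in> comp n r2 s"
proof -
  have s2: "2 * s \<le> n" using assms by simp
  define T where "T \<phi> = kerop n r1 r2 lam (up_map n s r1 \<phi>)" for \<phi>
  obtain c where c: "\<And>\<phi>. \<phi> \<in> Specht n s \<Longrightarrow> T \<phi> = (\<lambda>x. c * up_map n s r2 \<phi> x)"
  proof (rule Specht_equivariant_scalar[OF s2, of T r2])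
    show "T \<phi> \<in> L2Xr n r2" for \<phi> by (simp add: T_def L2Xr_def kerop_def)
  qed (auto simp: T_def Sym_def up_map_add up_map_scale kerop_add kerop_scale up_map_rho kerop_rho)
  obtain \<phi> where \<phi>: "\<phi> \<in> Specht n s" "\<psi> = up_map n s r1 \<phi>"
    using \<psi> comp_eq_up_map_image[OF assms(1-3)] by blast
  hence "kerop n r1 r2 lam \<psi> = up_map n s r2 (\<lambda>x. c * \<phi> x)"
    using c by (simp add: T_def up_map_scale)
  moreover have "(\<lambda>x. c * \<phi> x) \<in> Specht n s"
    using csubspace_Specht \<phi> by (simp add: csubspace_def)
  ultimately show ?thesis using comp_eq_up_map_image[OF assms(4-6)] by blast
qed

text \<open>Existence: the rows lie in the component, so the operator kills its orthogonal
  complement. Uniqueness: a candidate must annihilate certain indicators in that complement, which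
  yields the superset sums that determine it.\<close>

lemma lambda_poly_eq_hahn_poly:
  assumes "s \<le> r1" "s \<le> n - r1" "r1 \<le> n" "s \<le> r2" "s \<le> n - r2" "r2 \<le> n"
  shows "lambda_poly n r1 r2 s = hahn_poly n r1 r2 s"
  unfolding lambda_poly_def
proof (rule the_equality, intro conjI)
  let ?p = "hahn_poly n r1 r2 s"
  show "degree ?p = s" by (rule degree_hahn_poly[OF assms(1-4)])
  show "\<exists>lam. (\<forall>k. r2 - r1 \<le> k \<and> k \<le> min (n - r1) r2 \<longrightarrow> lam k = poly ?p (of_nat k))
      \<and> (\<forall>\<psi>\<in>comp n r1 s. kerop n r1 r2 lam \<psi> \<in> comp n r2 s)
      \<and> (\<forall>\<psi>\<in>L2X n. (\<forall>\<phi>\<in>comp n r1 s. inner n \<psi> \<phi> = 0) \<longrightarrow> kerop n r1 r2 lam \<psi> = (\<lambda>_. 0))"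
  proof (intro exI[of _ "\<lambda>k. poly ?p (of_nat k)"] conjI ballI impI)
    fix \<psi> assume orth: "\<forall>\<phi>\<in>comp n r1 s. inner n \<psi> \<phi> = 0"
    have "(\<Sum>x1\<in>Xr n r1. poly ?p (of_nat (card (x2 - x1))) * \<psi> x1) = 0" if "x2 \<in> Xr n r2" for x2
    proof -
      obtain \<phi> where \<phi>: "\<phi> \<in> Specht n s"
        "\<And>x1. x1 \<in> Xr n r1 \<Longrightarrow> up_map n s r1 \<phi> x1 = poly ?p (of_nat (card (x2 - x1)))"
        using hahn_poly_as_up_map[OF assms \<open>x2 \<in> Xr n r2\<close>] by blast
      \<comment> \<open>\<open>inner\<close> conjugates its second argument, so orthogonality is
        applied to the conjugate of the row.\<close>
      have "up_map n s r1 (\<lambda>x. cnj (\<phi> x)) \<in> comp n r1 s"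
        using comp_eq_up_map_image[OF assms(1-3)] cnj_in_Specht[OF \<phi>(1)] by blast
      hence "inner n \<psi> (up_map n s r1 (\<lambda>x. cnj (\<phi> x))) = 0" using orth by blast
      thus ?thesis
        unfolding inner_eq_sum_Xr[OF up_map_in_L2Xr] by (simp add: up_map_cnj \<phi>(2) mult.commute)
    qed
    thus "kerop n r1 r2 (\<lambda>k. poly ?p (of_nat k)) \<psi> = (\<lambda>_. 0)" by (auto simp: kerop_def)
  qed (auto intro: kerop_comp[OF assms])
next
  fix p assume p: "degree p = s \<and> poly p 0 = 1 \<and>
    (\<exists>lam. (\<forall>k. r2 - r1 \<le> k \<and> k \<le> min (n - r1) r2 \<longrightarrow> lam k = poly p (of_nat k))
      \<and> (\<forall>\<psi>\<in>comp n r1 s. kerop n r1 r2 lam \<psi> \<in> comp n r2 s)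
      \<and> (\<forall>\<psi>\<in>L2X n. (\<forall>\<phi>\<in>comp n r1 s. inner n \<psi> \<phi> = 0) \<longrightarrow> kerop n r1 r2 lam \<psi> = (\<lambda>_. 0)))"
  then obtain lam where lam: "\<forall>k. r2 - r1 \<le> k \<and> k \<le> min (n - r1) r2 \<longrightarrow> lam k = poly p (of_nat k)"
    and van: "\<forall>\<psi>\<in>L2X n. (\<forall>\<phi>\<in>comp n r1 s. inner n \<psi> \<phi> = 0) \<longrightarrow> kerop n r1 r2 lam \<psi> = (\<lambda>_. 0)"
    by blast
  have p_sums: "(\<Sum>x1\<in>{x1 \<in> Xr n r1. z \<subseteq> x1}. poly p (of_nat (card (x2 - x1)))) = 0"
    if "s \<ge> 1" "z \<in> Xr n (s - 1)" "x2 \<in> Xr n r2" for z x2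
  proof -
    \<comment> \<open>The test function is the indicator of the \<open>r1\<close>-sets containing
      \<open>z\<close>; it is orthogonal to the component by
      \<open>up_map_sum_supersets_eq_0\<close>.\<close>
    define \<psi> :: "nat set \<Rightarrow> complex" where "\<psi> = (\<lambda>x. if x \<in> Xr n r1 \<and> z \<subseteq> x then 1 else 0)"
    have "\<psi> \<in> L2X n" by (auto simp: L2X_def \<psi>_def Xr_def)
    moreover have "inner n \<psi> \<phi> = 0" if "\<phi> \<in> comp n r1 s" for \<phi>
    proof -
      obtain \<phi>' where \<phi>': "\<phi>' \<in> Specht n s" "\<phi> = up_map n s r1 \<phi>'"
        using \<open>\<phi> \<in> comp n r1 s\<close> comp_eq_up_map_image[OF assms(1-3)] by blast
      have "inner n \<psi> \<phi> = (\<Sum>x\<in>Xr n r1. if z \<subseteq> x then cnj (up_map n s r1 \<phi>' x) else 0)"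
        unfolding \<phi>'(2) inner_eq_sum_Xr[OF up_map_in_L2Xr]
        by (intro sum.cong refl) (simp add: \<psi>_def)
      also have "\<dots> = cnj (\<Sum>x\<in>{x \<in> Xr n r1. z \<subseteq> x}. up_map n s r1 \<phi>' x)"
        by (simp add: sum.inter_filter[symmetric])
      also have "\<dots> = 0"
        using up_map_sum_supersets_eq_0[OF \<phi>'(1)] \<open>s \<ge> 1\<close> \<open>z \<in> Xr n (s - 1)\<close> by simp
      finally show ?thesis .
    qed
    ultimately have "kerop n r1 r2 (\<lambda>k. poly p (of_nat k)) \<psi> x2 = 0"
      using van kerop_poly_cong[OF lam] by metis
    hence "0 = (\<Sum>x1\<in>Xr n r1. poly p (of_nat (card (x2 - x1))) * \<psi> x1)"
      using that(3) by (simp add: kerop_def)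
    also have "\<dots> = (\<Sum>x1\<in>Xr n r1. if z \<subseteq> x1 then poly p (of_nat (card (x2 - x1))) else 0)"
      by (intro sum.cong refl) (simp add: \<psi>_def)
    also have "\<dots> = (\<Sum>x1\<in>{x1 \<in> Xr n r1. z \<subseteq> x1}. poly p (of_nat (card (x2 - x1))))"
      by (simp add: sum.inter_filter)
    finally show ?thesis by simp
  qed
  have "p - hahn_poly n r1 r2 s = 0"
  proof (rule poly_eq_0_of_sum_supersets[OF _ _ assms])
    show "degree (p - hahn_poly n r1 r2 s) \<le> s"
      using p by (intro degree_diff_le) (simp_all add: degree_hahn_poly[OF assms(1-4)])
    show "poly (p - hahn_poly n r1 r2 s) 0 = 0" using p by simp
    show "(\<Sum>x1\<in>{x1 \<in> Xr n r1. z \<subseteq> x1}.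
        poly (p - hahn_poly n r1 r2 s) (of_nat (card (x2 - x1)))) = 0"
      if "s \<ge> 1" "z \<in> Xr n (s - 1)" "x2 \<in> Xr n r2" for z x2
      using p_sums[OF that] hahn_poly_sum_supersets_eq_0[OF that(1) assms(1-4) that(2,3)]
      by (simp add: sum_subtractf)
  qed
  thus "p = hahn_poly n r1 r2 s" by simp
qed simp

section \<open>The difference equation and the leading coefficient\<close>

lemma ffall_Suc: "ffall a (Suc j) = a * ffall (a - 1) j"
  unfolding ffall_def prod.lessThan_Suc_shift by (simp add: algebra_simps)

text \<open>Each falling factorial gives up its first factor. The remaining bases drop by one, which
  is the effect of passing to \<open>n - 2\<close>, \<open>r1 - 1\<close>, \<open>r2 - 1\<close> and
  \<open>s - 1\<close>.\<close>

lemma hahn_coeff_Suc: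
  assumes "n \<ge> 2" "r1 \<ge> 1" "r2 \<ge> 1" "s \<ge> 1"
  shows "hahn_coeff n r1 r2 s (Suc j) =
    - (of_nat s * (of_nat n - of_nat s + 1)) / (of_nat r2 * (of_nat n - of_nat r1))
      * hahn_coeff (n - 2) (r1 - 1) (r2 - 1) (s - 1) j"
proof -
  have "of_nat (n - 2) - of_nat (s - 1) + 1 = (of_nat n - of_nat s + 1 - 1 :: complex)"
    "of_nat (n - 2) - of_nat (r1 - 1) = (of_nat n - of_nat r1 - 1 :: complex)"
    "of_nat (s - 1) = (of_nat s - 1 :: complex)" "of_nat (r2 - 1) = (of_nat r2 - 1 :: complex)"
    using assms by (simp_all add: of_nat_diff)
  thus ?thesis
    unfolding hahn_coeff_def ffall_Suc by (simp only:) (simp add: mult_ac)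
qed

text \<open>By Pascal's rule the difference of \<open>t gchoose Suc j\<close> is
  \<open>t gchoose j\<close>, and the constant term cancels.\<close>

lemma hahn_poly_difference:
  assumes "n \<ge> 2" "r1 \<ge> 1" "r2 \<ge> 1" "s \<ge> 1"
  shows "poly (hahn_poly n r1 r2 s) (t + 1) - poly (hahn_poly n r1 r2 s) t =
    - (of_nat s * (of_nat n - of_nat s + 1)) / (of_nat r2 * (of_nat n - of_nat r1))
      * poly (hahn_poly (n - 2) (r1 - 1) (r2 - 1) (s - 1)) t"
proof -
  obtain s' where s': "s = Suc s'" using assms(4) by (cases s) auto
  have "poly (hahn_poly n r1 r2 s) (t + 1) - poly (hahn_poly n r1 r2 s) t
      = (\<Sum>j\<le>s'. hahn_coeff n r1 r2 s (Suc j) * (t gchoose j))"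
    unfolding hahn_poly_def poly_newton_sum s' sum.atMost_Suc_shift
    by (simp add: gbinomial_Suc_Suc distrib_left sum.distrib)
  thus ?thesis
    unfolding hahn_coeff_Suc[OF assms]
    by (simp add: hahn_poly_def poly_newton_sum s' sum_distrib_left mult.assoc)
qed

theorem theorem3:
  fixes n r1 r2 s :: nat
  assumes "r1 \<le> n" and "r2 \<le> n" and "s \<le> Nmin n r1 r2"
  shows "(\<forall>t::complex. poly (lambda_poly n r1 r2 s) t =
            (\<Sum>j=0..s. (-1)^j * (ffall t j / fact j) *
               (ffall (of_nat s) j * ffall (of_nat n - of_nat s + 1) j)
               / (ffall (of_nat n - of_nat r1) j * ffall (of_nat r2) j)))
       \<and> (s \<ge> 1 \<longrightarrow> (\<forall>t::complex.
            poly (lambda_poly n r1 r2 s) (t + 1) - poly (lambda_poly n r1 r2 s) t =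
            - (of_nat s * (of_nat n - of_nat s + 1)) / (of_nat r2 * (of_nat n - of_nat r1))
              * poly (lambda_poly (n - 2) (r1 - 1) (r2 - 1) (s - 1)) t))
       \<and> coeff (lambda_poly n r1 r2 s) s =
            (-1)^s * ffall (of_nat n - of_nat s + 1) s
              / (ffall (of_nat n - of_nat r1) s * ffall (of_nat r2) s)"
proof (intro conjI impI allI)
  have le: "s \<le> r1" "s \<le> n - r1" "r1 \<le> n" "s \<le> r2" "s \<le> n - r2" "r2 \<le> n"
    using assms by (auto simp: Nmin_def)
  note L = lambda_poly_eq_hahn_poly[OF le]
  show "poly (lambda_poly n r1 r2 s) t =
      (\<Sum>j=0..s. (-1)^j * (ffall t j / fact j) *
         (ffall (of_nat s) j * ffall (of_nat n - of_nat s + 1) j)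
         / (ffall (of_nat n - of_nat r1) j * ffall (of_nat r2) j))" for t
    unfolding L hahn_poly_def poly_newton_sum atMost_atLeast0
    by (intro sum.cong refl) (simp add: hahn_coeff_def ffall_gbinomial[of t])
  show "coeff (lambda_poly n r1 r2 s) s =
      (-1)^s * ffall (of_nat n - of_nat s + 1) s
        / (ffall (of_nat n - of_nat r1) s * ffall (of_nat r2) s)"
    \<comment> \<open>\<open>ffall (of_nat s) s = fact s\<close> cancels the factorial from the
      leading coefficient of the binomial polynomial.\<close>
    unfolding L coeff_hahn_poly hahn_coeff_def by (simp add: ffall_of_nat)
  show "poly (lambda_poly n r1 r2 s) (t + 1) - poly (lambda_poly n r1 r2 s) t =
      - (of_nat s * (of_nat n - of_nat s + 1)) / (of_nat r2 * (of_nat n - of_nat r1))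
        * poly (lambda_poly (n - 2) (r1 - 1) (r2 - 1) (s - 1)) t" if "s \<ge> 1" for t
  proof -
    \<comment> \<open>All bounds on \<open>s\<close> pass to \<open>s - 1\<close>, because
      \<open>r1\<close>, \<open>n - r1\<close>, \<open>r2\<close> and \<open>n - r2\<close> each
      drop by exactly one.\<close>
    have "lambda_poly (n - 2) (r1 - 1) (r2 - 1) (s - 1)
        = hahn_poly (n - 2) (r1 - 1) (r2 - 1) (s - 1)"
      using le that by (intro lambda_poly_eq_hahn_poly) auto
    thus ?thesis
      using hahn_poly_difference[of n r1 r2 s t] le that by (simp add: L)
  qed
qed

end
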